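(* There is a universal constant $c>0$ such that the following holds. Let $q$ be a prime power and let $f_1,\dots,f_t\colon\mathbb{F}_q^n\to\mathbb{F}_q$ be polynomials of degree at most $d$. Then there exists a partition of $\mathbb{F}_q^n$ into affine subspaces, each of dimension at least $c\cdot n^{1/(d-1)!}/t^{e}$, such that $f_1,\dots,f_t$ are all constant on each part.
   Context: $e$ is the base of the natural logarithm. Degree of a function on $\mathbb{F}_q^n$ means the total degree of its unique polynomial representation with individual degrees at most $q-1$.
   Formalization: The dimension bound is required only when c·n^{1/(d-1)!}/t^e ≥ 1 (below 1 only the partition is claimed), since literally it fails, e.g. n=t=d=1, f(x)=x, where all parts are points; also d ≥ 1 and t ≥ 1 are assumed, and F_q is taken with carrier a set of naturals. *)

theory Defs
  imports
    "HOL-Analysis.Analysis"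
    "HOL-Algebra.AbelCoset"
    "HOL-Algebra.Module"
    "HOL-Number_Theory.Prime_Powers"
begin

text \<open>
  The constant of the theorem is uniform in the finite field, and HOL cannot quantify over types below
  an existential quantifier. The field is therefore a record over \<open>nat\<close>: every finite field is
  isomorphic to one whose carrier is a set of natural numbers.

  The dimension bound is imposed where its value is at least 1. Without this reading it fails: for
  \<open>t = n \<ge> 1\<close> and \<open>f\<^sub>i(x) = x\<^sub>i\<close> all parts are single points, of dimension 0, while the bound is positive.
\<close>

text \<open>
  The coordinate space \<open>F\<^sup>n\<close>. Vectors are extensional functions on \<open>{..<n}\<close>, so that distinct
  functions are distinct points. The ring part of a module record carries the pointwise
  multiplication; it plays no role in what follows.
\<close>

definition coord_space :: "('a, 'b) ring_scheme \<Rightarrow> nat \<Rightarrow> ('a, nat \<Rightarrow> 'a) module" where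
  "coord_space F n =
     \<lparr> carrier = {..<n} \<rightarrow>\<^sub>E carrier F,
       mult = (\<lambda>x y. \<lambda>i\<in>{..<n}. x i \<otimes>\<^bsub>F\<^esub> y i),
       one = (\<lambda>i\<in>{..<n}. \<one>\<^bsub>F\<^esub>),
       zero = (\<lambda>i\<in>{..<n}. \<zero>\<^bsub>F\<^esub>),
       add = (\<lambda>x y. \<lambda>i\<in>{..<n}. x i \<oplus>\<^bsub>F\<^esub> y i),
       smult = (\<lambda>a x. \<lambda>i\<in>{..<n}. a \<otimes>\<^bsub>F\<^esub> x i) \<rparr>"

definition reduced_exponents :: "('a, 'b) ring_scheme \<Rightarrow> nat \<Rightarrow> (nat \<Rightarrow> nat) set" where
  "reduced_exponents F n = {..<n} \<rightarrow>\<^sub>E {..<order F}"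

definition eval_reduced ::
  "('a, 'b) ring_scheme \<Rightarrow> nat \<Rightarrow> ((nat \<Rightarrow> nat) \<Rightarrow> 'a) \<Rightarrow> (nat \<Rightarrow> 'a) \<Rightarrow> 'a" where
  "eval_reduced F n a x =
     (\<Oplus>\<^bsub>F\<^esub>e\<in>reduced_exponents F n. a e \<otimes>\<^bsub>F\<^esub> (\<Otimes>\<^bsub>F\<^esub>i\<in>{..<n}. x i [^]\<^bsub>F\<^esub> e i))"

text \<open>
  For a finite field \<open>F\<close> with \<open>q\<close> elements every function \<open>F\<^sup>n \<rightarrow> F\<close> is given by exactly one polynomial
  with individual degrees at most \<open>q - 1\<close>, so the coefficient family \<open>a\<close> below is determined by \<open>f\<close>
  on \<open>reduced_exponents F n\<close>, and its total degree is the degree of \<open>f\<close>.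
\<close>

definition degree_at_most ::
  "('a, 'b) ring_scheme \<Rightarrow> nat \<Rightarrow> nat \<Rightarrow> ((nat \<Rightarrow> 'a) \<Rightarrow> 'a) \<Rightarrow> bool" where
  "degree_at_most F n d f \<longleftrightarrow>
     (\<exists>a \<in> reduced_exponents F n \<rightarrow> carrier F.
        (\<forall>x \<in> carrier (coord_space F n). f x = eval_reduced F n a x) \<and>
        (\<forall>e \<in> reduced_exponents F n. a e \<noteq> \<zero>\<^bsub>F\<^esub> \<longrightarrow> (\<Sum>i<n. e i) \<le> d))"

definition lincomb ::
  "('a, 'c, 'd) module_scheme \<Rightarrow> nat \<Rightarrow> (nat \<Rightarrow> 'a) \<Rightarrow> (nat \<Rightarrow> 'c) \<Rightarrow> 'c" where
  "lincomb M k c b = (\<Oplus>\<^bsub>M\<^esub>j\<in>{..<k}. c j \<odot>\<^bsub>M\<^esub> b j)"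

definition is_basis ::
  "('a, 'b) ring_scheme \<Rightarrow> ('a, 'c, 'd) module_scheme \<Rightarrow> 'c set \<Rightarrow> nat \<Rightarrow> (nat \<Rightarrow> 'c) \<Rightarrow> bool" where
  "is_basis F M W k b \<longleftrightarrow>
     b \<in> {..<k} \<rightarrow> W \<and>
     (\<forall>w\<in>W. \<exists>c \<in> {..<k} \<rightarrow> carrier F. w = lincomb M k c b) \<and>
     (\<forall>c \<in> {..<k} \<rightarrow> carrier F. lincomb M k c b = \<zero>\<^bsub>M\<^esub> \<longrightarrow> (\<forall>j<k. c j = \<zero>\<^bsub>F\<^esub>))"

text \<open>\<open>V\<close> is an affine subspace of \<open>M\<close> of dimension \<open>k\<close>: a translate of a \<open>k\<close>-dimensional linear subspace.\<close>

definition affine_subspace_dim ::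
  "('a, 'b) ring_scheme \<Rightarrow> ('a, 'c, 'd) module_scheme \<Rightarrow> nat \<Rightarrow> 'c set \<Rightarrow> bool" where
  "affine_subspace_dim F M k V \<longleftrightarrow>
     (\<exists>W. \<exists>v \<in> carrier M. submodule W F M \<and> (\<exists>b. is_basis F M W k b) \<and> V = W +>\<^bsub>M\<^esub> v)"

lemma module_coord_space:
  fixes F (structure)
  assumes "field F"
  shows "module F (coord_space F n)"
proof -
  interpret field F by fact
  show ?thesis
  proof (rule moduleI)
    show "cring F" by (rule is_cring)
    show "abelian_group (coord_space F n)"
    proof (rule abelian_groupI)
      fix x assume "x \<in> carrier (coord_space F n)"
      then show "\<exists>y\<in>carrier (coord_space F n). y \<oplus>\<^bsub>coord_space F n\<^esub> x = \<zero>\<^bsub>coord_space F n\<^esub>"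
        by (intro bexI[of _ "\<lambda>i\<in>{..<n}. \<ominus> x i"])
           (auto simp: coord_space_def PiE_iff l_neg intro!: restrict_ext)
    qed (auto simp: coord_space_def PiE_iff extensional_def fun_eq_iff a_ac)
  qed (auto simp: coord_space_def PiE_iff extensional_def fun_eq_iff l_distr r_distr m_assoc)
qed

end

theory Submission
  imports Defs "HOL-Algebra.Multiplicative_Group"
begin

text \<open>
  Suppose the vectors \<open>b\<^sub>j\<close> span \<open>U\<close> and the degree \<open>d\<close> part of a polynomial, written as a
  (not necessarily symmetric) \<open>d\<close>-linear form, vanishes on all \<open>d\<close>-tuples of the \<open>b\<^sub>j\<close>. Then the
  restriction of the polynomial to every coset of \<open>U\<close> has degree at most \<open>d - 1\<close>, and one can recurse
  inside each coset. The \<open>b\<^sub>j\<close> are chosen one at a time: the conditions on vector number \<open>k + 1\<close>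
  for \<open>t\<close> forms, one for each word of length \<open>d\<close> in \<open>k + 1\<close> letters, have total degree
  \<open>t d (k + 1)\<^bsup>d-1\<^esup>\<close>, and \<open>k\<close> further linear conditions ensure independence, so the
  Chevalley-Warning theorem gives a nonzero solution as long as \<open>t d (k + 1)\<^bsup>d-1\<^esup> + k < n\<close>.
  Hence the dimension drops from \<open>n\<close> to about \<open>(n / t)\<^bsup>1/(d-1)\<^esup>\<close> in one step; over all steps the
  exponents of \<open>t\<close> and of the constants are partial sums of \<open>\<Sum> 1 / j!\<close>, hence at most \<open>e\<close> (plus 1
  for the constant).
\<close>

section \<open>Counting letters in words\<close>

text \<open>Each of the \<open>Suc d\<close> positions carries \<open>a\<close> in
  \<open>card A ^ d\<close> of the words. The letter count of a word is the degree of its condition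
  in the new vector, so this sum is what one form contributes to the total degree in
  Chevalley-Warning.\<close>

lemma sum_count_list:
  assumes "finite A" "a \<in> A"
  shows "(\<Sum>J | set J \<subseteq> A \<and> length J = Suc d. count_list J a) = Suc d * card A ^ d"
proof -
  \<comment> \<open>The induction starts at length 0, where the factor \<open>d\<close> makes the
    truncated exponent \<open>d - 1\<close> harmless.\<close>
  have "(\<Sum>J | set J \<subseteq> A \<and> length J = d. count_list J a) = d * card A ^ (d - 1)" for d
  proof (induction d)
    case 0
    have "{J. set J \<subseteq> A \<and> length J = 0} = {[]}" by auto
    then show ?case by (simp only: sum.insert sum.empty finite.emptyI) simp
  next
    case (Suc d)
    let ?X = "\<lambda>d. {J. set J \<subseteq> A \<and> length J = d}"
    have "(\<Sum>J\<in>?X (Suc d). count_list J a) = (\<Sum>(J, j)\<in>?X d \<times> A. count_list (j # J) a)"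
      unfolding lists_length_Suc_eq by (subst sum.reindex) (auto simp: inj_on_def split_def)
    also have "\<dots> = (\<Sum>J\<in>?X d. \<Sum>j\<in>A. (if j = a then 1 else 0) + count_list J a)"
      by (subst sum.cartesian_product) (auto intro!: sum.cong)
    also have "\<dots> = card (?X d) + card A * (\<Sum>J\<in>?X d. count_list J a)"
      using assms by (simp add: sum.distrib sum_Suc sum_distrib_left add.commute)
    also have "\<dots> = card A ^ d + card A * (d * card A ^ (d - 1))"
      using Suc.IH assms by (simp add: card_lists_length_eq)
    also have "\<dots> = Suc d * card A ^ d" by (cases d) (simp_all add: algebra_simps)
    finally show ?case by simp
  qed
  from this[of "Suc d"] show ?thesis by simp
qed

section \<open>Building partitions\<close>

text \<open>Two cells with a common point \<open>w\<close> both equal \<open>c w\<close>, so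
  distinct cells are disjoint.\<close>

lemma partition_on_cells:
  assumes "\<And>u. u \<in> A \<Longrightarrow> u \<in> c u" "\<And>u. u \<in> A \<Longrightarrow> c u \<subseteq> A"
    "\<And>u w. u \<in> A \<Longrightarrow> w \<in> c u \<Longrightarrow> c w = c u"
  shows "partition_on A (c ` A)"
proof (rule partition_onI)
  fix p q assume "p \<in> c ` A" "q \<in> c ` A" "p \<noteq> q"
  then show "disjnt p q"
    unfolding disjnt_def using assms(3) by blast
qed (use assms(1,2) in auto)

lemma partition_on_refine:
  assumes "partition_on A P" "\<And>p. p \<in> P \<Longrightarrow> partition_on p (Q p)"
  shows "partition_on A (\<Union>p\<in>P. Q p)"
proof (rule partition_onI)
  have "\<Union>(Q p) = p" if "p \<in> P" for p
    using partition_onD1[OF assms(2)[OF that]] by simp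
  then have "(\<Union>p\<in>P. \<Union>(Q p)) = \<Union>P" by simp
  then show "\<Union>(\<Union>p\<in>P. Q p) = A"
    using partition_onD1[OF assms(1)] by blast
  show "{} \<notin> (\<Union>p\<in>P. Q p)"
    using assms(2)[THEN partition_onD3] by blast
  fix r s assume "r \<in> (\<Union>p\<in>P. Q p)" "s \<in> (\<Union>p\<in>P. Q p)" "r \<noteq> s"
  then obtain p p' where *: "p \<in> P" "r \<in> Q p" "p' \<in> P" "s \<in> Q p'" by blast
  then have sub: "r \<subseteq> p" "s \<subseteq> p'"
    using assms(2)[THEN partition_onD1] by blast+
  show "disjnt r s"
  proof (cases "p = p'")
    case True
    then show ?thesis
      using * \<open>r \<noteq> s\<close> assms(2)[of p, THEN partition_onD2] by (auto simp: pairwise_def)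
  next
    case False
    then have "disjnt p p'"
      using * partition_onD2[OF assms(1)] by (auto simp: pairwise_def)
    with sub show ?thesis unfolding disjnt_def by blast
  qed
qed

section \<open>Linear combinations in a module\<close>

lemma (in module) lincomb_0: "lincomb M 0 c b = \<zero>\<^bsub>M\<^esub>"
  by (simp add: lincomb_def)

lemma (in module) lincomb_Suc:
  assumes "c \<in> {..<Suc k} \<rightarrow> carrier R" "b \<in> {..<Suc k} \<rightarrow> carrier M"
  shows "lincomb M (Suc k) c b = lincomb M k c b \<oplus>\<^bsub>M\<^esub> c k \<odot>\<^bsub>M\<^esub> b k"
proof -
  have "(\<lambda>j. c j \<odot>\<^bsub>M\<^esub> b j) \<in> {..<k} \<rightarrow> carrier M" "c k \<odot>\<^bsub>M\<^esub> b k \<in> carrier M"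
    using assms by (auto simp: Pi_iff)
  then show ?thesis
    unfolding lincomb_def lessThan_Suc
    by (subst finsum_insert) (auto simp: M.a_comm)
qed

lemma (in module) lincomb_closed:
  assumes "c \<in> {..<k} \<rightarrow> carrier R" "b \<in> {..<k} \<rightarrow> carrier M"
  shows "lincomb M k c b \<in> carrier M"
  unfolding lincomb_def using assms by (intro M.finsum_closed) (auto simp: Pi_iff)

lemma (in module) lincomb_cong:
  assumes "\<And>j. j < k \<Longrightarrow> c j = c' j" "\<And>j. j < k \<Longrightarrow> b j = b' j"
    "c' \<in> {..<k} \<rightarrow> carrier R" "b' \<in> {..<k} \<rightarrow> carrier M"
  shows "lincomb M k c b = lincomb M k c' b'"
  unfolding lincomb_def using assms by (intro M.finsum_cong') (auto simp: Pi_iff)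

lemma (in module) lincomb_zero:
  assumes "b \<in> {..<k} \<rightarrow> carrier M"
  shows "lincomb M k (\<lambda>_. \<zero>) b = \<zero>\<^bsub>M\<^esub>"
  unfolding lincomb_def using assms by (intro M.add.finprod_one_eqI) (auto simp: Pi_iff)

lemma (in module) lincomb_add:
  assumes "c \<in> {..<k} \<rightarrow> carrier R" "c' \<in> {..<k} \<rightarrow> carrier R" "b \<in> {..<k} \<rightarrow> carrier M"
  shows "lincomb M k (\<lambda>j. c j \<oplus> c' j) b = lincomb M k c b \<oplus>\<^bsub>M\<^esub> lincomb M k c' b"
proof -
  have "lincomb M k (\<lambda>j. c j \<oplus> c' j) b
      = (\<Oplus>\<^bsub>M\<^esub>j\<in>{..<k}. c j \<odot>\<^bsub>M\<^esub> b j \<oplus>\<^bsub>M\<^esub> c' j \<odot>\<^bsub>M\<^esub> b j)"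
    unfolding lincomb_def using assms
    by (intro M.finsum_cong') (auto simp: Pi_iff smult_l_distr)
  then show ?thesis
    unfolding lincomb_def using assms by (subst (asm) M.finsum_addf) (auto simp: Pi_iff)
qed

lemma (in module) lincomb_smult:
  assumes "c \<in> {..<k} \<rightarrow> carrier R" "a \<in> carrier R" "b \<in> {..<k} \<rightarrow> carrier M"
  shows "lincomb M k (\<lambda>j. a \<otimes> c j) b = a \<odot>\<^bsub>M\<^esub> lincomb M k c b"
  unfolding lincomb_def using assms
  by (subst finsum_smult_ldistr) (auto simp: Pi_iff smult_assoc1 intro!: M.finsum_cong')

section \<open>Coordinate spaces over a finite field\<close>

locale finite_field = field R for R (structure) +
  assumes finite_carrier [simp]: "finite (carrier R)"
begin

abbreviation "V \<equiv> coord_space R"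
abbreviation "pts n \<equiv> carrier (V n)"

lemma module_V: "module R (V n)"
  by (rule module_coord_space[OF field_axioms])

sublocale V: module R "V n" for n
  by (rule module_V)

lemma pts_eq: "pts n = {..<n} \<rightarrow>\<^sub>E carrier R"
  by (simp add: coord_space_def)

lemma finite_pts [simp]: "finite (pts n)"
  by (simp add: pts_eq finite_PiE)

lemma coord_closed [simp, intro]: "x \<in> pts n \<Longrightarrow> i < n \<Longrightarrow> x i \<in> carrier R"
  by (auto simp: pts_eq)

lemma pts_eqI: "x \<in> pts n \<Longrightarrow> y \<in> pts n \<Longrightarrow> (\<And>i. i < n \<Longrightarrow> x i = y i) \<Longrightarrow> x = y"
  unfolding pts_eq by (rule PiE_ext) auto

lemma V_add [simp]: "i < n \<Longrightarrow> (x \<oplus>\<^bsub>V n\<^esub> y) i = x i \<oplus> y i"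
  and V_smult [simp]: "i < n \<Longrightarrow> (a \<odot>\<^bsub>V n\<^esub> x) i = a \<otimes> x i"
  and V_zero [simp]: "i < n \<Longrightarrow> \<zero>\<^bsub>V n\<^esub> i = \<zero>"
  by (simp_all add: coord_space_def)

lemma pts_Pi: "y \<in> pts k \<Longrightarrow> y \<in> {..<k} \<rightarrow> carrier R"
  by (auto simp: pts_eq)

subsection \<open>Monomials and polynomial functions\<close>

text \<open>A monomial is a word of variable indices rather than an exponent vector: its length is
  the degree, and its positions serve as the slots of a multilinear form.\<close>

primrec tval :: "nat list \<Rightarrow> (nat \<Rightarrow> 'a) list \<Rightarrow> 'a" where
  "tval [] vs = \<one>"
| "tval (i # l) vs = hd vs i \<otimes> tval l (tl vs)"

primrec mval :: "nat list \<Rightarrow> (nat \<Rightarrow> 'a) \<Rightarrow> 'a" where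
  "mval [] x = \<one>"
| "mval (i # l) x = x i \<otimes> mval l x"

lemma tval_replicate: "tval l (replicate (length l) x) = mval l x"
  by (induction l) auto

lemma mval_closed [simp]: "set l \<subseteq> {..<n} \<Longrightarrow> x \<in> pts n \<Longrightarrow> mval l x \<in> carrier R"
  by (induction l) auto

lemma tval_closed [simp]:
  "set l \<subseteq> {..<n} \<Longrightarrow> length vs = length l \<Longrightarrow> set vs \<subseteq> pts n \<Longrightarrow> tval l vs \<in> carrier R"
proof (induction l arbitrary: vs)
  case (Cons i l)
  then show ?case by (cases vs) auto
qed auto

lemma mval_append:
  "set l \<subseteq> {..<n} \<Longrightarrow> set l' \<subseteq> {..<n} \<Longrightarrow> x \<in> pts n \<Longrightarrow> mval (l @ l') x = mval l x \<otimes> mval l' x"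
  by (induction l) (auto simp: m_assoc[symmetric] coord_closed)

text \<open>
  Exponents are not reduced modulo \<open>x\<^sup>q = x\<close> here, so the degree \<open>d\<close> is only an upper bound.
\<close>

inductive polyfun :: "nat \<Rightarrow> nat \<Rightarrow> ((nat \<Rightarrow> 'a) \<Rightarrow> 'a) \<Rightarrow> bool" for n d where
  zero: "polyfun n d (\<lambda>_. \<zero>)"
| add_mon: "polyfun n d f \<Longrightarrow> c \<in> carrier R \<Longrightarrow> set l \<subseteq> {..<n} \<Longrightarrow> length l \<le> d \<Longrightarrow>
    polyfun n d (\<lambda>x. f x \<oplus> c \<otimes> mval l x)"
| congr: "polyfun n d f \<Longrightarrow> (\<And>x. x \<in> pts n \<Longrightarrow> f x = g x) \<Longrightarrow> polyfun n d g"

lemma polyfun_closed: "polyfun n d f \<Longrightarrow> x \<in> pts n \<Longrightarrow> f x \<in> carrier R"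
  by (induction rule: polyfun.induct) auto

lemma polyfun_mono: "polyfun n d f \<Longrightarrow> d \<le> d' \<Longrightarrow> polyfun n d' f"
  by (induction rule: polyfun.induct) (auto intro: polyfun.intros)

lemma polyfun_mon:
  assumes "c \<in> carrier R" "set l \<subseteq> {..<n}" "length l \<le> d"
  shows "polyfun n d (\<lambda>x. c \<otimes> mval l x)"
  by (rule polyfun.congr[OF polyfun.add_mon[OF polyfun.zero assms]]) (use assms in simp)

lemma polyfun_const: "c \<in> carrier R \<Longrightarrow> polyfun n d (\<lambda>_. c)"
  by (rule polyfun.congr[OF polyfun_mon[of c "[]"]]) auto

lemma polyfun_coord: "i < n \<Longrightarrow> d \<ge> 1 \<Longrightarrow> polyfun n d (\<lambda>x. x i)"
  by (rule polyfun.congr[OF polyfun_mon[of \<one> "[i]"]]) (auto simp: coord_closed)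

lemma polyfun_add:
  assumes "polyfun n d f" "polyfun n d g"
  shows "polyfun n d (\<lambda>x. f x \<oplus> g x)"
  using assms(2)
proof (induction rule: polyfun.induct)
  case zero
  show ?case by (rule polyfun.congr[OF assms(1)]) (auto simp: polyfun_closed[OF assms(1)])
next
  case (add_mon g c l)
  show ?case
    by (rule polyfun.congr[OF polyfun.add_mon[OF add_mon.IH add_mon.hyps(2-4)]])
       (use add_mon.hyps in \<open>auto simp: a_assoc polyfun_closed[OF assms(1)] polyfun_closed[OF add_mon.hyps(1)]\<close>)
next
  case (congr g g')
  show ?case by (rule polyfun.congr[OF congr.IH]) (simp add: congr.hyps)
qed

lemma polyfun_mult_mon:
  assumes "polyfun n d f" "c \<in> carrier R" "set l \<subseteq> {..<n}"
  shows "polyfun n (length l + d) (\<lambda>x. (c \<otimes> mval l x) \<otimes> f x)"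
  using assms(1)
proof (induction rule: polyfun.induct)
  case zero
  show ?case by (rule polyfun.congr[OF polyfun.zero]) (use assms in auto)
next
  case (add_mon f c' l')
  show ?case
  proof (rule polyfun.congr[OF polyfun.add_mon[OF add_mon.IH, of "c \<otimes> c'" "l @ l'"]])
    fix x assume x: "x \<in> pts n"
    note [simp] = polyfun_closed[OF add_mon.hyps(1) x]
    have "mval l x \<in> carrier R" "mval l' x \<in> carrier R" using x add_mon.hyps assms by simp_all
    then show "c \<otimes> mval l x \<otimes> f x \<oplus> c \<otimes> c' \<otimes> mval (l @ l') x
        = c \<otimes> mval l x \<otimes> (f x \<oplus> c' \<otimes> mval l' x)"
      using add_mon.hyps assms x by (simp add: mval_append r_distr m_ac)
  qed (use add_mon.hyps assms in auto)
next
  case (congr g g')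
  show ?case by (rule polyfun.congr[OF congr.IH]) (simp add: congr.hyps)
qed

lemma polyfun_mult:
  assumes "polyfun n d f" "polyfun n d' g"
  shows "polyfun n (d + d') (\<lambda>x. f x \<otimes> g x)"
  using assms(1)
proof (induction rule: polyfun.induct)
  case zero
  show ?case by (rule polyfun.congr[OF polyfun.zero]) (simp add: polyfun_closed[OF assms(2)])
next
  case (add_mon f c l)
  have "polyfun n (d + d') (\<lambda>x. (c \<otimes> mval l x) \<otimes> g x)"
    by (rule polyfun_mono[OF polyfun_mult_mon[OF assms(2)]]) (use add_mon.hyps in auto)
  from polyfun_add[OF add_mon.IH this] show ?case
    by (rule polyfun.congr)
       (use add_mon.hyps in \<open>auto simp: l_distr polyfun_closed[OF assms(2)] polyfun_closed[OF add_mon.hyps(1)]\<close>)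
next
  case (congr f f')
  show ?case by (rule polyfun.congr[OF congr.IH]) (simp add: congr.hyps)
qed

lemma polyfun_uminus: "polyfun n d f \<Longrightarrow> polyfun n d (\<lambda>x. \<ominus> f x)"
  by (rule polyfun.congr[OF polyfun_mult[where d = 0, OF polyfun_const[of "\<ominus> \<one>"]], simplified])
     (auto simp: l_minus polyfun_closed)

lemma polyfun_pow: "polyfun n d f \<Longrightarrow> polyfun n (k * d) (\<lambda>x. f x [^] k)"
proof (induction k)
  case 0
  then show ?case by (simp add: polyfun_const)
next
  case (Suc k)
  from polyfun_mult[OF Suc.IH[OF Suc.prems] Suc.prems] show ?case
    by (simp add: add.commute)
qed

lemma polyfun_finprod:
  assumes "finite A" "\<And>a. a \<in> A \<Longrightarrow> polyfun n (D a) (f a)"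
  shows "polyfun n (\<Sum>a\<in>A. D a) (\<lambda>x. \<Otimes>a\<in>A. f a x)"
  using assms
proof (induction rule: finite_induct)
  case empty
  then show ?case by (simp add: polyfun_const)
next
  case (insert a A)
  from polyfun_mult[OF insert.prems[of a] insert.IH] insert
  have "polyfun n (\<Sum>a\<in>insert a A. D a) (\<lambda>x. f a x \<otimes> (\<Otimes>a\<in>A. f a x))" by simp
  then show ?case
    by (rule polyfun.congr)
       (use insert in \<open>auto simp: finprod_insert Pi_iff polyfun_closed[OF insert.prems]\<close>)
qed

lemma polyfun_finsum:
  assumes "finite A" "\<And>a. a \<in> A \<Longrightarrow> polyfun n d (f a)"
  shows "polyfun n d (\<lambda>x. \<Oplus>a\<in>A. f a x)"
  using assms
proof (induction rule: finite_induct)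
  case empty
  then show ?case by (simp add: polyfun_const)
next
  case (insert a A)
  from polyfun_add[OF insert.prems[of a] insert.IH] insert
  have "polyfun n d (\<lambda>x. f a x \<oplus> (\<Oplus>a\<in>A. f a x))" by simp
  then show ?case
    by (rule polyfun.congr)
       (use insert in \<open>auto simp: finsum_insert Pi_iff polyfun_closed[OF insert.prems]\<close>)
qed

lemma polyfun_degree_at_most:
  assumes "degree_at_most R n d f"
  shows "polyfun n d f"
proof -
  let ?E = "reduced_exponents R n"
  obtain a where a: "a \<in> ?E \<rightarrow> carrier R" "\<And>x. x \<in> pts n \<Longrightarrow> f x = eval_reduced R n a x"
    "\<And>e. e \<in> ?E \<Longrightarrow> a e \<noteq> \<zero> \<Longrightarrow> (\<Sum>i<n. e i) \<le> d"
    using assms unfolding degree_at_most_def by auto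
  have "polyfun n d (\<lambda>x. \<Oplus>e\<in>?E. a e \<otimes> (\<Otimes>i\<in>{..<n}. x i [^] e i))"
  proof (rule polyfun_finsum)
    show "finite ?E" by (simp add: reduced_exponents_def finite_PiE)
    fix e assume e: "e \<in> ?E"
    have *: "polyfun n (\<Sum>i<n. e i) (\<lambda>x. \<Otimes>i\<in>{..<n}. x i [^] e i)"
    proof (rule polyfun_finprod)
      fix i assume "i \<in> {..<n}"
      then show "polyfun n (e i) (\<lambda>x. x i [^] e i)"
        using polyfun_pow[OF polyfun_coord[of i n 1], of "e i"] by simp
    qed simp
    show "polyfun n d (\<lambda>x. a e \<otimes> (\<Otimes>i\<in>{..<n}. x i [^] e i))"
    proof (cases "a e = \<zero>")
      \<comment> \<open>The degree bound covers only monomials with nonzero coefficient; the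
        remaining summands are zero functions.\<close>
      case True
      show ?thesis
        by (rule polyfun.congr[OF polyfun.zero]) (auto simp: True finprod_closed Pi_iff)
    next
      case False
      then have "(\<Sum>i<n. e i) \<le> d" using a(3) e by blast
      from polyfun_mono[OF polyfun_mult[where d = 0, OF polyfun_const *, of "a e"], simplified, OF _ this]
      show ?thesis using a(1) e by (auto simp: Pi_iff)
    qed
  qed
  then show ?thesis
    by (rule polyfun.congr) (simp add: a(2) eval_reduced_def)
qed

subsection \<open>The Chevalley-Warning theorem\<close>

lemma order_gt_1: "1 < order R"
  using card_mono[OF finite_carrier, of "{\<zero>, \<one>}"] by (simp add: order_def)

text \<open>\<open>X ^ e - 1\<close> has at most \<open>e\<close> roots, fewer than there are
  nonzero elements.\<close>

lemma exists_pow_neq_one: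
  assumes "0 < e" "e < order R - 1"
  shows "\<exists>a\<in>carrier R - {\<zero>}. a [^] e \<noteq> \<one>"
proof (rule ccontr)
  assume "\<not> ?thesis"
  then have "carrier R - {\<zero>} \<subseteq> {x \<in> carrier R. x [^] e = \<one>}" by auto
  then have "card (carrier R - {\<zero>}) \<le> card {x \<in> carrier R. x [^] e = \<one>}"
    by (intro card_mono) auto
  also have "\<dots> \<le> e" using num_roots_le_deg[of e] assms by simp
  finally show False using assms by (simp add: order_def)
qed

text \<open>Scaling by a nonzero \<open>a\<close> permutes the field, so the sum \<open>S\<close>
  satisfies \<open>a ^ e * S = S\<close>; an \<open>a\<close> with \<open>a ^ e\<close> different
  from 1 forces \<open>S = 0\<close>.\<close>

lemma power_sum_zero:
  assumes "e < order R - 1"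
  shows "(\<Oplus>a\<in>carrier R. a [^] e) = \<zero>"
proof (cases "e = 0")
  case True
  \<comment> \<open>Since \<zero> to the power 0 is \<one>, every summand is \<one>, and the sum is
    the field order times \<one>.\<close>
  then have "(\<Oplus>a\<in>carrier R. a [^] e) = [order R] \<cdot> \<one>"
    by (simp add: add.finprod_const order_def)
  also have "\<dots> = \<zero>"
    using add.pow_order_eq_1[of \<one>] by (simp add: order_def)
  finally show ?thesis .
next
  case False
  then obtain a where a: "a \<in> carrier R" "a \<noteq> \<zero>" "a [^] e \<noteq> \<one>"
    using exists_pow_neq_one assms by blast
  let ?S = "\<Oplus>x\<in>carrier R. x [^] e"
  have S: "?S \<in> carrier R" by (rule finsum_closed) auto
  have inj: "inj_on (\<lambda>x. a \<otimes> x) (carrier R)"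
    using a by (auto simp: inj_on_def m_lcancel)
  then have surj: "(\<lambda>x. a \<otimes> x) ` carrier R = carrier R"
    using a by (intro endo_inj_surj) auto
  have "a [^] e \<otimes> ?S = (\<Oplus>x\<in>carrier R. a [^] e \<otimes> x [^] e)"
    using a by (intro finsum_rdistr) auto
  also have "\<dots> = (\<Oplus>x\<in>carrier R. (a \<otimes> x) [^] e)"
    using a by (intro finsum_cong') (auto simp: nat_pow_distrib)
  also have "\<dots> = (\<Oplus>x\<in>(\<lambda>x. a \<otimes> x) ` carrier R. x [^] e)"
    using a by (intro add.finprod_reindex[symmetric] inj) auto
  finally have "a [^] e \<otimes> ?S = \<one> \<otimes> ?S"
    using S by (simp add: surj)
  then show ?thesis
    using a S m_rcancel[of ?S "a [^] e" \<one>] by auto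
qed

lemma pow_order_minus_one:
  assumes "x \<in> carrier R" "x \<noteq> \<zero>"
  shows "x [^] (order R - 1) = \<one>"
proof -
  interpret G: group "mult_of R" by (rule field_mult_group)
  show ?thesis
    using G.pow_order_eq_1[of x] assms by (simp add: order_mult_of nat_pow_mult_of one_mult_of)
qed

lemma fun_upd_pts [simp]: "x \<in> pts n \<Longrightarrow> i < n \<Longrightarrow> a \<in> carrier R \<Longrightarrow> x(i := a) \<in> pts n"
  by (auto simp: pts_eq PiE_iff extensional_def)

text \<open>The lines in direction \<open>i\<close> partition the space, and each meets the
  hyperplane \<open>x i = \<zero>\<close> in exactly one point, which serves as its
  representative.\<close>

lemma finsum_pts_split:
  assumes "i < n" "f \<in> pts n \<rightarrow> carrier R"
  shows "(\<Oplus>x\<in>pts n. f x) = (\<Oplus>x\<in>{x \<in> pts n. x i = \<zero>}. \<Oplus>a\<in>carrier R. f (x(i := a)))"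
proof -
  let ?B = "{x \<in> pts n. x i = \<zero>}" and ?A = "\<lambda>x. (\<lambda>a. x(i := a)) ` carrier R"
  have eq: "pts n = \<Union>(?A ` ?B)"
  proof
    show "pts n \<subseteq> \<Union>(?A ` ?B)"
    proof
      fix x assume "x \<in> pts n"
      then have "x(i := \<zero>) \<in> ?B" "x \<in> ?A (x(i := \<zero>))"
        using assms(1) by (auto intro!: image_eqI[of _ _ "x i"])
      then show "x \<in> \<Union>(?A ` ?B)" by blast
    qed
  qed (use assms(1) in auto)
  have disj: "pairwise (\<lambda>x y. disjnt (?A x) (?A y)) ?B"
  proof (intro pairwiseI)
    fix x y assume xy: "x \<in> ?B" "y \<in> ?B" "x \<noteq> y"
    have "x = y" if "x(i := a) = y(i := b)" for a b
    proof
      fix j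
      show "x j = y j" using fun_cong[OF that, of j] xy by (cases "j = i") auto
    qed
    with xy show "disjnt (?A x) (?A y)" by (auto simp: disjnt_def)
  qed
  have "(\<Oplus>x\<in>pts n. f x) = (\<Oplus>x\<in>?B. \<Oplus>y\<in>?A x. f y)"
    by (subst eq, rule add.finprod_UN_disjoint) (use assms disj in auto)
  also have "\<dots> = (\<Oplus>x\<in>?B. \<Oplus>a\<in>carrier R. f (x(i := a)))"
  proof (rule finsum_cong')
    fix x assume x: "x \<in> ?B"
    show "(\<Oplus>y\<in>?A x. f y) = (\<Oplus>a\<in>carrier R. f (x(i := a)))"
      using x assms by (intro add.finprod_reindex) (auto simp: inj_on_def dest: fun_upd_eqD)
  qed (use assms in \<open>auto intro!: finsum_closed\<close>)
  finally show ?thesis .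
qed

lemma mval_fun_upd:
  assumes "set l \<subseteq> {..<n}" "x \<in> pts n" "i < n" "a \<in> carrier R"
  shows "mval l (x(i := a)) = mval (filter (\<lambda>j. j \<noteq> i) l) x \<otimes> a [^] count_list l i"
  using assms(1)
proof (induction l)
  case (Cons j l)
  moreover have "mval (filter (\<lambda>j. j \<noteq> i) l) x \<in> carrier R"
    using Cons.prems assms by (intro mval_closed[of _ n]) auto
  ultimately show ?case
    using assms by (auto simp: m_ac)
qed auto

text \<open>By pigeonhole some variable occurs fewer than \<open>order R - 1\<close> times; summing
  over that variable first produces a vanishing power sum.\<close>

lemma finsum_mval_zero:
  assumes "set l \<subseteq> {..<n}" "length l < n * (order R - 1)"
  shows "(\<Oplus>x\<in>pts n. mval l x) = \<zero>"
proof -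
  have "\<exists>i<n. count_list l i < order R - 1"
  proof (rule ccontr)
    assume "\<not> ?thesis"
    then have "(\<Sum>i<n. order R - 1) \<le> (\<Sum>i<n. count_list l i)"
      by (intro sum_mono) (use not_less in blast)
    also have "\<dots> = length l" using assms(1) by (intro sum_count_set) auto
    finally show False using assms(2) by simp
  qed
  then obtain i where i: "i < n" "count_list l i < order R - 1" by blast
  let ?l = "filter (\<lambda>j. j \<noteq> i) l"
  have "(\<Oplus>x\<in>pts n. mval l x) = (\<Oplus>x\<in>{x \<in> pts n. x i = \<zero>}. \<Oplus>a\<in>carrier R. mval l (x(i := a)))"
    using i assms by (intro finsum_pts_split) auto
  also have "\<dots> = (\<Oplus>x\<in>{x \<in> pts n. x i = \<zero>}. \<zero>)"
  proof (rule finsum_cong')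
    fix x assume x: "x \<in> {x \<in> pts n. x i = \<zero>}"
    have c: "mval ?l x \<in> carrier R" using x assms by (intro mval_closed[of _ n]) auto
    have "(\<Oplus>a\<in>carrier R. mval l (x(i := a))) = (\<Oplus>a\<in>carrier R. mval ?l x \<otimes> a [^] count_list l i)"
      using x i assms c by (intro finsum_cong') (auto simp: mval_fun_upd)
    also have "\<dots> = mval ?l x \<otimes> (\<Oplus>a\<in>carrier R. a [^] count_list l i)"
      using c by (intro finsum_rdistr[symmetric]) auto
    finally show "(\<Oplus>a\<in>carrier R. mval l (x(i := a))) = \<zero>"
      using c power_sum_zero[OF i(2)] by simp
  qed auto
  finally show ?thesis by simp
qed

lemma polyfun_finsum_zero:
  assumes "polyfun n d f" "d < n * (order R - 1)"
  shows "(\<Oplus>x\<in>pts n. f x) = \<zero>"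
  using assms(1)
proof (induction rule: polyfun.induct)
  case (add_mon f c l)
  have "(\<Oplus>x\<in>pts n. f x \<oplus> c \<otimes> mval l x) = (\<Oplus>x\<in>pts n. f x) \<oplus> (\<Oplus>x\<in>pts n. c \<otimes> mval l x)"
    using add_mon.hyps by (intro finsum_addf) (auto simp: polyfun_closed)
  also have "(\<Oplus>x\<in>pts n. c \<otimes> mval l x) = c \<otimes> (\<Oplus>x\<in>pts n. mval l x)"
    using add_mon.hyps by (intro finsum_rdistr[symmetric]) auto
  finally show ?case
    using add_mon finsum_mval_zero[of l n] assms(2) by simp
next
  case (congr f g)
  have "(\<Oplus>x\<in>pts n. g x) = (\<Oplus>x\<in>pts n. f x)"
    using congr.hyps by (intro finsum_cong') (auto dest: polyfun_closed)
  with congr.IH show ?case by simp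
qed simp

text \<open>
  \<open>D\<close> bounds the sum of the degrees of equations defining \<open>Z\<close>. Phrased through the indicator
  function, this is additive under intersections, and Chevalley-Warning only needs the indicator.
\<close>

definition zero_locus :: "nat \<Rightarrow> nat \<Rightarrow> ((nat \<Rightarrow> 'a) \<Rightarrow> bool) \<Rightarrow> bool" where
  "zero_locus n D Z \<longleftrightarrow>
     (\<exists>G. polyfun n ((order R - 1) * D) G \<and> (\<forall>x\<in>pts n. G x = (if Z x then \<one> else \<zero>)))"

text \<open>With \<open>q = order R\<close>, the indicator is \<open>1 - f ^ (q - 1)\<close>, since
  nonzero field elements satisfy \<open>x ^ (q - 1) = 1\<close>.\<close>

lemma zero_locus_polyfun:
  assumes "polyfun n D f"
  shows "zero_locus n D (\<lambda>x. f x = \<zero>)"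
proof -
  let ?G = "\<lambda>x. \<one> \<oplus> \<ominus> (f x [^] (order R - 1))"
  have "polyfun n ((order R - 1) * D) ?G"
    by (intro polyfun_add polyfun_const polyfun_uminus polyfun_pow assms) simp
  moreover have "?G x = (if f x = \<zero> then \<one> else \<zero>)" if "x \<in> pts n" for x
    using polyfun_closed[OF assms that] order_gt_1
    by (auto simp: pow_order_minus_one r_neg nat_pow_zero simp del: One_nat_def)
  ultimately show ?thesis
    unfolding zero_locus_def by blast
qed

text \<open>Indicators multiply and their degrees add.\<close>

lemma zero_locus_Ball:
  assumes "finite A" "\<And>a. a \<in> A \<Longrightarrow> zero_locus n (D a) (Z a)"
  shows "zero_locus n (\<Sum>a\<in>A. D a) (\<lambda>x. \<forall>a\<in>A. Z a x)"
proof -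
  obtain G where G: "\<And>a. a \<in> A \<Longrightarrow> polyfun n ((order R - 1) * D a) (G a)"
    "\<And>a x. a \<in> A \<Longrightarrow> x \<in> pts n \<Longrightarrow> G a x = (if Z a x then \<one> else \<zero>)"
    using assms(2) unfolding zero_locus_def by metis
  have "polyfun n ((order R - 1) * (\<Sum>a\<in>A. D a)) (\<lambda>x. \<Otimes>a\<in>A. G a x)"
    unfolding sum_distrib_left by (intro polyfun_finprod assms G)
  moreover have "(\<Otimes>a\<in>A. G a x) = (if \<forall>a\<in>A. Z a x then \<one> else \<zero>)" if x: "x \<in> pts n" for x
    using assms(1) G(2)[OF _ x]
  proof (induction rule: finite_induct)
    case (insert a A)
    then have "(\<Otimes>a\<in>insert a A. G a x) = G a x \<otimes> (\<Otimes>a\<in>A. G a x)"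
      by (intro finprod_insert) auto
    then show ?case using insert by auto
  qed simp
  ultimately show ?thesis
    unfolding zero_locus_def by blast
qed

text \<open>If the origin were the only solution, the indicator would sum to \<one> over the space;
  but its degree is below \<open>n * (order R - 1)\<close>, so it sums to \<zero>.\<close>

theorem chevalley_warning:
  assumes "zero_locus n D Z" "D < n" "Z \<zero>\<^bsub>V n\<^esub>"
  shows "\<exists>x\<in>pts n. x \<noteq> \<zero>\<^bsub>V n\<^esub> \<and> Z x"
proof (rule ccontr)
  assume *: "\<not> ?thesis"
  obtain G where G: "polyfun n ((order R - 1) * D) G"
    "\<And>x. x \<in> pts n \<Longrightarrow> G x = (if Z x then \<one> else \<zero>)"
    using assms(1) unfolding zero_locus_def by blast
  have "(\<Oplus>x\<in>pts n. G x) = (\<Oplus>x\<in>pts n. if x = \<zero>\<^bsub>V n\<^esub> then \<one> else \<zero>)"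
    using G(2) * assms(3) by (intro finsum_cong') auto
  also have "\<dots> = \<one>"
    using finsum_singleton[of "\<zero>\<^bsub>V n\<^esub>" "pts n" "\<lambda>_. \<one>"] by (simp add: eq_commute)
  finally have "(\<Oplus>x\<in>pts n. G x) = \<one>" .
  moreover have "(\<Oplus>x\<in>pts n. G x) = \<zero>"
    using G(1) order_gt_1 assms(2) by (intro polyfun_finsum_zero) auto
  ultimately show False by simp
qed

subsection \<open>Restriction to cosets of a subspace\<close>

text \<open>
  \<open>tval\<close> evaluates each factor of a monomial at its own vector. The forms are not symmetrized,
  which would fail in characteristic at most \<open>d\<close>.
\<close>

inductive tensor :: "nat \<Rightarrow> nat \<Rightarrow> ((nat \<Rightarrow> 'a) list \<Rightarrow> 'a) \<Rightarrow> bool" for n d where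
  zero: "tensor n d (\<lambda>_. \<zero>)"
| add_tval: "tensor n d T \<Longrightarrow> c \<in> carrier R \<Longrightarrow> set l \<subseteq> {..<n} \<Longrightarrow> length l = d \<Longrightarrow>
    tensor n d (\<lambda>vs. T vs \<oplus> c \<otimes> tval l vs)"

lemma tensor_closed:
  "tensor n d T \<Longrightarrow> length vs = d \<Longrightarrow> set vs \<subseteq> pts n \<Longrightarrow> T vs \<in> carrier R"
  by (induction rule: tensor.induct) auto

text \<open>Words of full length \<open>Suc d\<close> go into \<open>T\<close>, shorter ones into
  \<open>g\<close>; the polynomial sees \<open>T\<close> on the diagonal only.\<close>

lemma polyfun_top_part:
  assumes "polyfun n (Suc d) f"
  shows "\<exists>T g. tensor n (Suc d) T \<and> polyfun n d g \<and>
           (\<forall>x\<in>pts n. f x = T (replicate (Suc d) x) \<oplus> g x)"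
  using assms
proof (induction rule: polyfun.induct)
  case zero
  then show ?case
    by (intro exI[of _ "\<lambda>_. \<zero>"] conjI tensor.zero polyfun.zero) auto
next
  case (add_mon f c l)
  then obtain T g where Tg: "tensor n (Suc d) T" "polyfun n d g"
    "\<And>x. x \<in> pts n \<Longrightarrow> f x = T (replicate (Suc d) x) \<oplus> g x" by blast
  have cl: "T (replicate (Suc d) x) \<in> carrier R" "g x \<in> carrier R" "mval l x \<in> carrier R"
    if "x \<in> pts n" for x
    using that Tg add_mon.hyps by (auto intro: tensor_closed polyfun_closed simp del: replicate_Suc)
  show ?case
  proof (cases "length l = Suc d")
    case True
    then have "f x \<oplus> c \<otimes> mval l x = (T (replicate (Suc d) x) \<oplus> c \<otimes> tval l (replicate (Suc d) x)) \<oplus> g x"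
      if "x \<in> pts n" for x
      using that Tg(3) cl[OF that] add_mon.hyps tval_replicate[of l x]
      by (simp add: a_ac del: replicate_Suc)
    moreover have "tensor n (Suc d) (\<lambda>vs. T vs \<oplus> c \<otimes> tval l vs)"
      using True add_mon.hyps Tg by (intro tensor.add_tval) auto
    ultimately show ?thesis using Tg(2) by blast
  next
    case False
    then have "f x \<oplus> c \<otimes> mval l x = T (replicate (Suc d) x) \<oplus> (g x \<oplus> c \<otimes> mval l x)"
      if "x \<in> pts n" for x
      using that Tg(3) cl[OF that] add_mon.hyps by (simp add: a_assoc del: replicate_Suc)
    moreover have "polyfun n d (\<lambda>x. g x \<oplus> c \<otimes> mval l x)"
      using False add_mon.hyps Tg by (intro polyfun.add_mon) auto
    ultimately show ?thesis using Tg(1) by blast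
  qed
qed auto

lemma tval_linear:
  assumes "set l \<subseteq> {..<n}" "length l = length us + Suc (length ws)"
    "set us \<subseteq> pts n" "set ws \<subseteq> pts n" "v \<in> pts n" "w \<in> pts n" "a \<in> carrier R"
  shows "tval l (us @ (v \<oplus>\<^bsub>V n\<^esub> a \<odot>\<^bsub>V n\<^esub> w) # ws)
       = tval l (us @ v # ws) \<oplus> a \<otimes> tval l (us @ w # ws)"
  using assms(1-3)
proof (induction l arbitrary: us)
  case (Cons i l)
  show ?case
  proof (cases us)
    case Nil
    then have "tval l ws \<in> carrier R" using Cons.prems assms by (intro tval_closed[of _ n]) auto
    with Nil Cons.prems assms show ?thesis by (simp add: l_distr m_assoc coord_closed)
  next
    case (Cons u us')
    then have "tval l (us' @ v # ws) \<in> carrier R" "tval l (us' @ w # ws) \<in> carrier R"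
      using Cons.prems assms by (auto intro!: tval_closed[of _ n])
    moreover have "u i \<in> carrier R" using Cons Cons.prems by auto
    ultimately show ?thesis
      using Cons Cons.prems Cons.IH[of us'] assms by (simp add: r_distr m_ac)
  qed
qed simp

lemma tval_zero:
  assumes "set l \<subseteq> {..<n}" "length l = length us + Suc (length ws)"
    "set us \<subseteq> pts n" "set ws \<subseteq> pts n"
  shows "tval l (us @ \<zero>\<^bsub>V n\<^esub> # ws) = \<zero>"
  using assms(1-3)
proof (induction l arbitrary: us)
  case (Cons i l)
  then show ?case using assms(4) by (cases us) auto
qed simp

text \<open>Additivity and homogeneity in one slot are combined in the shape that
  \<open>lincomb_Suc\<close> produces.\<close>

lemma tensor_linear:
  assumes "tensor n d T" "d = length us + Suc (length ws)"
    "set us \<subseteq> pts n" "set ws \<subseteq> pts n" "v \<in> pts n" "w \<in> pts n" "a \<in> carrier R"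
  shows "T (us @ (v \<oplus>\<^bsub>V n\<^esub> a \<odot>\<^bsub>V n\<^esub> w) # ws) = T (us @ v # ws) \<oplus> a \<otimes> T (us @ w # ws)"
  using assms(1)
proof (induction rule: tensor.induct)
  case (add_tval T c l)
  have "T (us @ v # ws) \<in> carrier R" "T (us @ w # ws) \<in> carrier R"
    using add_tval.hyps assms by (auto intro!: tensor_closed)
  moreover have "tval l (us @ v # ws) \<in> carrier R" "tval l (us @ w # ws) \<in> carrier R"
    using add_tval.hyps assms by (auto intro!: tval_closed[of _ n])
  ultimately show ?case
    using add_tval assms by (simp add: tval_linear r_distr a_ac m_ac)
qed (use assms in simp)

lemma tensor_zero:
  assumes "tensor n d T" "d = length us + Suc (length ws)"
    "set us \<subseteq> pts n" "set ws \<subseteq> pts n"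
  shows "T (us @ \<zero>\<^bsub>V n\<^esub> # ws) = \<zero>"
  using assms(1) by (induction rule: tensor.induct) (use assms in \<open>auto simp: tval_zero\<close>)

lemma tensor_lincomb_zero:
  assumes "tensor n d T" "d = length us + Suc (length ws)" "set us \<subseteq> pts n" "set ws \<subseteq> pts n"
    "y \<in> {..<k} \<rightarrow> carrier R" "b \<in> {..<k} \<rightarrow> pts n" "\<And>j. j < k \<Longrightarrow> T (us @ b j # ws) = \<zero>"
  shows "T (us @ lincomb (V n) k y b # ws) = \<zero>"
  using assms(5-7)
proof (induction k)
  case 0
  show ?case using assms by (simp add: V.lincomb_0 tensor_zero)
next
  case (Suc k)
  then have *: "y \<in> {..<k} \<rightarrow> carrier R" "b \<in> {..<k} \<rightarrow> pts n" "b k \<in> pts n" "y k \<in> carrier R"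
    by (auto simp: Pi_iff)
  have "T (us @ lincomb (V n) (Suc k) y b # ws)
      = T (us @ lincomb (V n) k y b # ws) \<oplus> y k \<otimes> T (us @ b k # ws)"
    unfolding V.lincomb_Suc[OF Suc.prems(1,2)]
    by (rule tensor_linear[OF assms(1-4)]) (use * V.lincomb_closed in auto)
  also have "\<dots> = \<zero>" using Suc * by simp
  finally show ?case .
qed

lemma tensor_span_zero:
  assumes "tensor n d T" "y \<in> {..<k} \<rightarrow> carrier R" "b \<in> {..<k} \<rightarrow> pts n"
    "\<And>J. length J = d \<Longrightarrow> set J \<subseteq> {..<k} \<Longrightarrow> T (map b J) = \<zero>"
  shows "T (replicate d (lincomb (V n) k y b)) = \<zero>"
proof -
  let ?L = "lincomb (V n) k y b"
  have L: "?L \<in> pts n" using assms by (intro V.lincomb_closed) auto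
  \<comment> \<open>The first \<open>m\<close> slots hold the combination, the rest hold spanning
    vectors. Expanding the last of \<open>Suc m\<close> such slots prepends a letter to
    \<open>J\<close>, so the claim for \<open>m\<close> and all words gives the claim for
    \<open>Suc m\<close>.\<close>
  have "T (replicate m ?L @ map b J) = \<zero>" if "m + length J = d" "set J \<subseteq> {..<k}" for m J
    using that
  proof (induction m arbitrary: J)
    case 0
    then show ?case using assms(4) by simp
  next
    case (Suc m)
    have "T (replicate m ?L @ ?L # map b J) = \<zero>"
    proof (rule tensor_lincomb_zero[OF assms(1) _ _ _ assms(2,3)])
      fix j assume "j < k"
      then show "T (replicate m ?L @ b j # map b J) = \<zero>"
        using Suc.IH[of "j # J"] Suc.prems by simp
    qed (use Suc.prems L assms(3) in \<open>auto simp: Pi_iff\<close>)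
    then show ?case by (simp add: replicate_append_same replicate_app_Cons_same)
  qed
  from this[of d "[]"] show ?thesis by simp
qed

lemma polyfun_lincomb_coord:
  assumes "b \<in> {..<k} \<rightarrow> pts n" "i < n"
  shows "polyfun k 1 (\<lambda>y. lincomb (V n) k y b i)"
proof -
  \<comment> \<open>\<open>m\<close> truncates the sum while the number \<open>k\<close> of
    variables stays fixed.\<close>
  have "polyfun k 1 (\<lambda>y. lincomb (V n) m y b i)" if "m \<le> k" for m
    using that
  proof (induction m)
    case 0
    then show ?case using assms by (simp add: V.lincomb_0 polyfun_const)
  next
    case (Suc m)
    have "b m i \<in> carrier R" using assms Suc.prems by (auto simp: Pi_iff)
    then have "polyfun k (1 + 0) (\<lambda>y. y m \<otimes> b m i)"
      using Suc.prems by (intro polyfun_mult polyfun_coord polyfun_const) auto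
    then have "polyfun k 1 (\<lambda>y. lincomb (V n) m y b i \<oplus> y m \<otimes> b m i)"
      using Suc by (intro polyfun_add) auto
    then show ?case
    proof (rule polyfun.congr)
      fix y assume "y \<in> pts k"
      then show "lincomb (V n) m y b i \<oplus> y m \<otimes> b m i = lincomb (V n) (Suc m) y b i"
        using Suc.prems assms by (subst V.lincomb_Suc) (auto simp: Pi_iff)
    qed
  qed
  then show ?thesis by simp
qed

lemma polyfun_mval_comp:
  assumes "\<And>i. i < n \<Longrightarrow> polyfun k 1 (\<lambda>y. L y i)" "set l \<subseteq> {..<n}"
  shows "polyfun k (length l) (\<lambda>y. mval l (L y))"
  using assms(2)
proof (induction l)
  case (Cons i l)
  have "polyfun k (1 + length l) (\<lambda>y. L y i \<otimes> mval l (L y))"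
    using Cons assms(1) by (intro polyfun_mult) auto
  then show ?case by simp
qed (simp add: polyfun_const)

lemma polyfun_comp:
  assumes "polyfun n d f" "\<And>i. i < n \<Longrightarrow> polyfun k 1 (\<lambda>y. L y i)"
    "\<And>y. y \<in> pts k \<Longrightarrow> L y \<in> pts n"
  shows "polyfun k d (\<lambda>y. f (L y))"
  using assms(1)
proof (induction rule: polyfun.induct)
  case (add_mon f c l)
  have "polyfun k (0 + length l) (\<lambda>y. c \<otimes> mval l (L y))"
    using add_mon.hyps assms(2) by (intro polyfun_mult polyfun_const polyfun_mval_comp) auto
  then show ?case
    using add_mon by (intro polyfun_add) (auto intro: polyfun_mono)
next
  case (congr f g)
  show ?case by (rule polyfun.congr[OF congr.IH]) (simp add: congr.hyps assms(3))
qed (rule polyfun.zero)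

text \<open>One letter is peeled off by
  \<open>(u + L) M(u + L) - L M(L) = u M(u + L) + L (M(u + L) - M(L))\<close>, where
  \<open>M\<close> is the remaining monomial: the first summand has a constant in place of one
  factor, the second is handled by induction.\<close>

lemma polyfun_mval_translate_diff:
  assumes L: "\<And>i. i < n \<Longrightarrow> polyfun k 1 (\<lambda>y. L y i)" "\<And>y. y \<in> pts k \<Longrightarrow> L y \<in> pts n"
    and u: "u \<in> pts n" and "set l \<subseteq> {..<n}" "length l = Suc d"
  shows "polyfun k d (\<lambda>y. mval l (u \<oplus>\<^bsub>V n\<^esub> L y) \<oplus> \<ominus> mval l (L y))"
  using assms(4,5)
proof (induction l arbitrary: d)
  case (Cons i l)
  let ?U = "\<lambda>y. u \<oplus>\<^bsub>V n\<^esub> L y"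
  let ?D = "\<lambda>y. mval l (?U y) \<oplus> \<ominus> mval l (L y)"
  have U: "?U y \<in> pts n" if "y \<in> pts k" for y using L(2)[OF that] u by simp
  have Ui: "polyfun k 1 (\<lambda>y. ?U y j)" if "j < n" for j
    using that L(1)[OF that] u by (simp add: polyfun_add polyfun_const)
  have i: "i < n" "set l \<subseteq> {..<n}" using Cons.prems by auto
  have 1: "polyfun k d (\<lambda>y. u i \<otimes> mval l (?U y))"
    using polyfun_mult[OF polyfun_const[of "u i" k 0] polyfun_mval_comp[of n k ?U l, OF Ui i(2)]] i u Cons.prems
    by auto
  have 2: "polyfun k d (\<lambda>y. L y i \<otimes> ?D y)"
  proof (cases d)
    \<comment> \<open>The induction hypothesis requires a nonempty tail; for an empty tail the
      difference is \<one> minus \<one>.\<close>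
    case 0
    then have "l = []" using Cons.prems by simp
    then show ?thesis
      by (intro polyfun.congr[OF polyfun.zero]) (auto simp: r_neg coord_closed[OF L(2) i(1)])
  next
    case (Suc d')
    then have "polyfun k (1 + d') (\<lambda>y. L y i \<otimes> ?D y)"
      using Cons i by (intro polyfun_mult L(1) Cons.IH) auto
    then show ?thesis using Suc by simp
  qed
  show ?case
  proof (rule polyfun.congr[OF polyfun_add[OF 1 2]])
    fix y assume y: "y \<in> pts k"
    have cl: "u i \<in> carrier R" "L y i \<in> carrier R" "mval l (?U y) \<in> carrier R" "mval l (L y) \<in> carrier R"
      using u i L(2)[OF y] U[OF y] by auto
    have "mval (i # l) (?U y) \<oplus> \<ominus> mval (i # l) (L y)
      = (u i \<oplus> L y i) \<otimes> mval l (?U y) \<oplus> \<ominus> (L y i \<otimes> mval l (L y))" using i by simp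
    also have "\<dots> = u i \<otimes> mval l (?U y) \<oplus> L y i \<otimes> ?D y"
      using cl by (simp add: l_distr r_distr r_minus a_ac)
    finally show "u i \<otimes> mval l (?U y) \<oplus> L y i \<otimes> ?D y
        = mval (i # l) (?U y) \<oplus> \<ominus> mval (i # l) (L y)" by simp
  qed
qed simp

lemma polyfun_tensor_translate_diff:
  assumes L: "\<And>i. i < n \<Longrightarrow> polyfun k 1 (\<lambda>y. L y i)" "\<And>y. y \<in> pts k \<Longrightarrow> L y \<in> pts n"
    and u: "u \<in> pts n" and "tensor n (Suc d) T"
  shows "polyfun k d (\<lambda>y. T (replicate (Suc d) (u \<oplus>\<^bsub>V n\<^esub> L y)) \<oplus> \<ominus> T (replicate (Suc d) (L y)))"
  using assms(4)
proof (induction rule: tensor.induct)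
  case zero
  show ?case by (rule polyfun.congr[OF polyfun.zero]) (simp add: r_neg)
next
  case (add_tval T c l)
  let ?U = "\<lambda>y. u \<oplus>\<^bsub>V n\<^esub> L y"
  have "polyfun k (0 + d) (\<lambda>y. c \<otimes> (mval l (?U y) \<oplus> \<ominus> mval l (L y)))"
    using add_tval.hyps L u
    by (intro polyfun_mult polyfun_const polyfun_mval_translate_diff) auto
  then have "polyfun k d (\<lambda>y. c \<otimes> (mval l (?U y) \<oplus> \<ominus> mval l (L y)))" by simp
  from polyfun_add[OF add_tval.IH this] show ?case
  proof (rule polyfun.congr)
    fix y assume y: "y \<in> pts k"
    have *: "L y \<in> pts n" "?U y \<in> pts n" using L(2)[OF y] u by auto
    have cl: "T (replicate (Suc d) (L y)) \<in> carrier R" "T (replicate (Suc d) (?U y)) \<in> carrier R"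
      "mval l (L y) \<in> carrier R" "mval l (?U y) \<in> carrier R" "c \<in> carrier R"
      using * add_tval.hyps by (auto intro!: tensor_closed[of n "Suc d" T] simp del: replicate_Suc)
    have tv: "tval l (replicate (Suc d) x) = mval l x" for x
      using tval_replicate[of l x] add_tval.hyps by simp
    show "T (replicate (Suc d) (?U y)) \<oplus> \<ominus> T (replicate (Suc d) (L y)) \<oplus>
          c \<otimes> (mval l (?U y) \<oplus> \<ominus> mval l (L y)) =
         T (replicate (Suc d) (?U y)) \<oplus> c \<otimes> tval l (replicate (Suc d) (?U y)) \<oplus>
          \<ominus> (T (replicate (Suc d) (L y)) \<oplus> c \<otimes> tval l (replicate (Suc d) (L y)))"
      unfolding tv using cl by (simp add: r_distr r_minus minus_add a_ac del: replicate_Suc)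
  qed
qed

text \<open>Here the degree drops: \<open>T\<close> vanishes on the span, so subtracting its value
  at the linear part changes nothing, and the translation difference has degree at most
  \<open>d\<close>. The same \<open>b\<close> works for every base point \<open>u\<close>.\<close>

lemma polyfun_restrict:
  assumes f: "\<And>x. x \<in> pts n \<Longrightarrow> f x = T (replicate (Suc d) x) \<oplus> g x"
    and T: "tensor n (Suc d) T" and g: "polyfun n d g"
    and b: "b \<in> {..<k} \<rightarrow> pts n" and u: "u \<in> pts n"
    and zero: "\<And>J. length J = Suc d \<Longrightarrow> set J \<subseteq> {..<k} \<Longrightarrow> T (map b J) = \<zero>"
  shows "polyfun k d (\<lambda>y. f (u \<oplus>\<^bsub>V n\<^esub> lincomb (V n) k y b))"
proof -
  let ?L = "\<lambda>y. lincomb (V n) k y b"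
  let ?U = "\<lambda>y. u \<oplus>\<^bsub>V n\<^esub> ?L y"
  have L: "polyfun k 1 (\<lambda>y. ?L y i)" if "i < n" for i
    using polyfun_lincomb_coord[OF b that] .
  have L': "?L y \<in> pts n" if "y \<in> pts k" for y
    using V.lincomb_closed[OF pts_Pi[OF that] b] .
  have "polyfun k d (\<lambda>y. g (?U y))"
  proof (rule polyfun_comp[OF g])
    show "polyfun k 1 (\<lambda>y. ?U y i)" if "i < n" for i
      using that L[OF that] u by (simp add: polyfun_add polyfun_const)
  qed (use L' u in auto)
  from polyfun_add[OF polyfun_tensor_translate_diff[OF L L' u T] this] show ?thesis
  proof (rule polyfun.congr)
    fix y assume y: "y \<in> pts k"
    have "T (replicate (Suc d) (?L y)) = \<zero>"
      by (rule tensor_span_zero[OF T pts_Pi[OF y] b zero])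
    moreover have "?U y \<in> pts n" "T (replicate (Suc d) (?U y)) \<in> carrier R"
      using L'[OF y] u by (auto intro!: tensor_closed[OF T] simp del: replicate_Suc)
    ultimately show "T (replicate (Suc d) (?U y)) \<oplus> \<ominus> T (replicate (Suc d) (?L y)) \<oplus> g (?U y) = f (?U y)"
      by (simp add: f del: replicate_Suc)
  qed
qed

subsection \<open>Choosing the subspace\<close>

lemma zero_locus_conj:
  assumes "zero_locus n D Z" "zero_locus n D' Z'"
  shows "zero_locus n (D + D') (\<lambda>x. Z x \<and> Z' x)"
proof -
  \<comment> \<open>A conjunction is treated as a bounded quantifier over
    \<open>bool\<close>.\<close>
  have "zero_locus n (if s then D else D') (if s then Z else Z')" for s :: bool
    using assms by simp
  from zero_locus_Ball[of UNIV n "\<lambda>s. if s then D else D'" "\<lambda>s. if s then Z else Z'", OF finite this] show ?thesis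
    by (simp add: UNIV_bool ex_bool_eq all_bool_eq add.commute conj_commute)
qed

text \<open>Each occurrence of \<open>k\<close> in \<open>J\<close> contributes a coordinate of
  \<open>v\<close>, of degree 1; every other letter contributes a constant.\<close>

lemma polyfun_tval_slots:
  assumes "b \<in> {..<k} \<rightarrow> pts n" "set l \<subseteq> {..<n}" "length l = length J" "set J \<subseteq> {..<Suc k}"
  shows "polyfun n (count_list J k) (\<lambda>v. tval l (map (b(k := v)) J))"
  using assms(2-4)
proof (induction l arbitrary: J)
  case (Cons i l)
  then obtain j J' where J: "J = j # J'" by (cases J) auto
  have IH: "polyfun n (count_list J' k) (\<lambda>v. tval l (map (b(k := v)) J'))"
    using Cons.IH[of J'] Cons.prems J by (simp del: fun_upd_apply)
  show ?case
  proof (cases "j = k")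
    case True
    then show ?thesis
      using polyfun_mult[OF polyfun_coord[of i n 1] IH] Cons.prems J
      by (simp del: fun_upd_apply add: fun_upd_same)
  next
    case False
    then have "b j i \<in> carrier R" using Cons.prems J assms(1) by (auto simp: Pi_iff)
    then show ?thesis
      using polyfun_mult[OF polyfun_const[of "b j i" n 0] IH] False J
      by (simp del: fun_upd_apply add: fun_upd_other)
  qed
qed (simp add: polyfun_const)

lemma polyfun_tensor_slots:
  assumes "b \<in> {..<k} \<rightarrow> pts n" "tensor n d T" "length J = d" "set J \<subseteq> {..<Suc k}"
  shows "polyfun n (count_list J k) (\<lambda>v. T (map (b(k := v)) J))"
  using assms(2)
proof (induction rule: tensor.induct)
  case (add_tval T c l)
  then have "polyfun n (0 + count_list J k) (\<lambda>v. c \<otimes> tval l (map (b(k := v)) J))"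
    using assms by (intro polyfun_mult polyfun_const polyfun_tval_slots) auto
  then show ?case using add_tval.IH by (intro polyfun_add) (simp_all del: fun_upd_apply)
qed (rule polyfun.zero)

text \<open>
  For \<open>Q = {..<n}\<close> this is linear independence. A smaller \<open>Q\<close> is a certificate: a new nonzero vector
  vanishing on \<open>Q\<close> is automatically independent of the old ones, at the price of \<open>card Q\<close> linear equations.
\<close>

definition indep_on :: "nat \<Rightarrow> nat \<Rightarrow> (nat \<Rightarrow> nat \<Rightarrow> 'a) \<Rightarrow> nat set \<Rightarrow> bool" where
  "indep_on n k b Q \<longleftrightarrow> (\<forall>y\<in>{..<k} \<rightarrow> carrier R.
     (\<forall>p\<in>Q. lincomb (V n) k y b p = \<zero>) \<longrightarrow> (\<forall>j<k. y j = \<zero>))"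

text \<open>The new vector vanishes on \<open>Q\<close>, so the old certificate forces the first
  \<open>k\<close> coefficients to be zero; the coordinate \<open>p\<close> then detects the last
  one.\<close>

lemma indep_on_extend:
  assumes b: "b \<in> {..<k} \<rightarrow> pts n" and ind: "indep_on n k b Q" and Q: "Q \<subseteq> {..<n}"
    and v: "v \<in> pts n" "\<And>p. p \<in> Q \<Longrightarrow> v p = \<zero>" and p: "p < n" "v p \<noteq> \<zero>"
  shows "indep_on n (Suc k) (b(k := v)) (insert p Q)"
  unfolding indep_on_def
proof (intro ballI impI allI)
  let ?b = "b(k := v)"
  fix y j assume y: "y \<in> {..<Suc k} \<rightarrow> carrier R" and j: "j < Suc k"
    and 0: "\<forall>q\<in>insert p Q. lincomb (V n) (Suc k) y ?b q = \<zero>"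
  have y': "y \<in> {..<k} \<rightarrow> carrier R" "y k \<in> carrier R" using y by (auto simp: Pi_iff)
  have b': "?b \<in> {..<Suc k} \<rightarrow> pts n" using b v by (auto simp: Pi_iff)
  have L: "lincomb (V n) k y b \<in> pts n" using V.lincomb_closed[OF y'(1) b] .
  have "lincomb (V n) k y ?b = lincomb (V n) k y b"
    using b y' by (intro V.lincomb_cong) auto
  then have eq: "lincomb (V n) (Suc k) y ?b = lincomb (V n) k y b \<oplus>\<^bsub>V n\<^esub> y k \<odot>\<^bsub>V n\<^esub> v"
    by (simp add: V.lincomb_Suc[OF y b'])
  have "lincomb (V n) k y b q = \<zero>" if q: "q \<in> Q" for q
  proof -
    have "q < n" using q Q by auto
    moreover have "(lincomb (V n) k y b \<oplus>\<^bsub>V n\<^esub> y k \<odot>\<^bsub>V n\<^esub> v) q = \<zero>"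
      using 0 q unfolding eq by blast
    ultimately show ?thesis using v(2)[OF q] y'(2) L by simp
  qed
  then have yz: "y j = \<zero>" if "j < k" for j
    using ind y' that unfolding indep_on_def by blast
  have "lincomb (V n) k y b = lincomb (V n) k (\<lambda>_. \<zero>) b"
    using yz b by (intro V.lincomb_cong) auto
  also have "\<dots> = \<zero>\<^bsub>V n\<^esub>" by (rule V.lincomb_zero[OF b])
  finally have "y k \<otimes> v p = \<zero>" using 0 p v y' unfolding eq by simp
  then have "y k = \<zero>" using p v y' integral[of "y k" "v p"] by auto
  with yz show "y j = \<zero>" using j by (cases "j = k") auto
qed

text \<open>Greedy choice, with one Chevalley-Warning solution per vector. The dimension hypothesis
  is monotone in \<open>k\<close>, so it passes to the earlier stages.\<close>

lemma common_isotropic_vectors: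
  assumes T: "\<And>i. i < t \<Longrightarrow> tensor n (Suc d) (T i)" and "t * (Suc d * k ^ d) + k \<le> n"
  shows "\<exists>b Q. b \<in> {..<k} \<rightarrow> pts n \<and> Q \<subseteq> {..<n} \<and> card Q \<le> k \<and> indep_on n k b Q \<and>
    (\<forall>i<t. \<forall>J. length J = Suc d \<longrightarrow> set J \<subseteq> {..<k} \<longrightarrow> T i (map b J) = \<zero>)"
  using assms(2)
proof (induction k)
  case 0
  show ?case by (intro exI[of _ "\<lambda>_. undefined"] exI[of _ "{}"]) (auto simp: indep_on_def)
next
  case (Suc k)
  have "t * (Suc d * k ^ d) \<le> t * (Suc d * Suc k ^ d)"
    by (intro mult_le_mono power_mono) auto
  then have "t * (Suc d * k ^ d) + k \<le> n" using Suc.prems by linarith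
  from Suc.IH[OF this] obtain b Q where b: "b \<in> {..<k} \<rightarrow> pts n" and Q: "Q \<subseteq> {..<n}" "card Q \<le> k"
    and ind: "indep_on n k b Q"
    and vanish: "\<And>i J. i < t \<Longrightarrow> length J = Suc d \<Longrightarrow> set J \<subseteq> {..<k} \<Longrightarrow> T i (map b J) = \<zero>"
    by blast
  \<comment> \<open>Words without the letter \<open>k\<close> are included: their conditions hold
    already and have degree 0 in the new vector.\<close>
  let ?Js = "{J. set J \<subseteq> {..<Suc k} \<and> length J = Suc d}"
  let ?Z = "\<lambda>v. (\<forall>i\<in>{..<t}. \<forall>J\<in>?Js. T i (map (b(k := v)) J) = \<zero>) \<and> (\<forall>p\<in>Q. v p = \<zero>)"
  have finQ: "finite Q" using Q finite_subset by blast
  have "zero_locus n ((\<Sum>i\<in>{..<t}. \<Sum>J\<in>?Js. count_list J k) + (\<Sum>p\<in>Q. 1)) ?Z"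
  proof (intro zero_locus_conj zero_locus_Ball finQ)
    show "finite ?Js" by (rule finite_lists_length_eq) simp
    show "zero_locus n (count_list J k) (\<lambda>v. T i (map (b(k := v)) J) = \<zero>)"
      if "i \<in> {..<t}" "J \<in> ?Js" for i J
      using that by (intro zero_locus_polyfun polyfun_tensor_slots[OF b T[of i]]) auto
    show "zero_locus n 1 (\<lambda>v. v p = \<zero>)" if "p \<in> Q" for p
      using that Q by (intro zero_locus_polyfun polyfun_coord) auto
  qed simp
  \<comment> \<open>The summand \<open>Suc k\<close> in the hypothesis leaves one to spare over
    \<open>card Q \<le> k\<close>, which makes the inequality strict.\<close>
  moreover have "(\<Sum>i\<in>{..<t}. \<Sum>J\<in>?Js. count_list J k) + (\<Sum>p\<in>Q. 1) < n"
    using sum_count_list[of "{..<Suc k}" k d] Suc.prems Q(2) by simp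
  \<comment> \<open>Words that contain \<open>k\<close> give zero by linearity in that slot, the
    others by the choice of the earlier vectors.\<close>
  moreover have "?Z \<zero>\<^bsub>V n\<^esub>"
  proof (intro conjI ballI)
    fix i J assume i: "i \<in> {..<t}" and J: "J \<in> ?Js"
    show "T i (map (b(k := \<zero>\<^bsub>V n\<^esub>)) J) = \<zero>"
    proof (cases "k \<in> set J")
      case True
      then obtain us ws where J': "J = us @ k # ws" by (meson in_set_conv_decomp)
      have "(b(k := \<zero>\<^bsub>V n\<^esub>)) j \<in> pts n" if "j < Suc k" for j
        using that b by (auto simp: Pi_iff)
      then have "set (map (b(k := \<zero>\<^bsub>V n\<^esub>)) J) \<subseteq> pts n"
        using J by (auto simp del: fun_upd_apply)
      then show ?thesis
        using tensor_zero[OF T[of i], of "map (b(k := \<zero>\<^bsub>V n\<^esub>)) us" "map (b(k := \<zero>\<^bsub>V n\<^esub>)) ws"] i J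
        unfolding J' by (simp del: fun_upd_apply add: fun_upd_same)
    next
      case False
      then have "set J \<subseteq> {..<k}" using J by (auto simp: less_Suc_eq)
      moreover have eq: "map (b(k := \<zero>\<^bsub>V n\<^esub>)) J = map b J" using False by (intro map_cong) auto
      ultimately show ?thesis unfolding eq using vanish i J by simp
    qed
  qed (use Q in auto)
  ultimately obtain v where v: "v \<in> pts n" "v \<noteq> \<zero>\<^bsub>V n\<^esub>" "?Z v"
    using chevalley_warning by blast
  \<comment> \<open>A coordinate where \<open>v\<close> is nonzero lies outside \<open>Q\<close> and
    enlarges the certificate by one index.\<close>
  obtain p where p: "p < n" "v p \<noteq> \<zero>"
    using v pts_eqI[of v n "\<zero>\<^bsub>V n\<^esub>"] by auto
  have "indep_on n (Suc k) (b(k := v)) (insert p Q)"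
    using indep_on_extend[OF b ind Q(1) v(1) _ p] v(3) by blast
  moreover have "b(k := v) \<in> {..<Suc k} \<rightarrow> pts n" using b v by (auto simp: Pi_iff)
  moreover have "insert p Q \<subseteq> {..<n}" "card (insert p Q) \<le> Suc k"
    using Q p by (auto intro: card_insert_le_m1)
  moreover have "\<forall>i<t. \<forall>J. length J = Suc d \<longrightarrow> set J \<subseteq> {..<Suc k} \<longrightarrow> T i (map (b(k := v)) J) = \<zero>"
    using v(3) by blast
  ultimately show ?case by blast
qed

subsection \<open>Parametrized affine subspaces\<close>

lemma lincomb_V_add:
  assumes "b \<in> {..<k} \<rightarrow> pts n" "x \<in> pts k" "y \<in> pts k"
  shows "lincomb (V n) k (x \<oplus>\<^bsub>V k\<^esub> y) b = lincomb (V n) k x b \<oplus>\<^bsub>V n\<^esub> lincomb (V n) k y b"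
proof -
  have "lincomb (V n) k (x \<oplus>\<^bsub>V k\<^esub> y) b = lincomb (V n) k (\<lambda>j. x j \<oplus> y j) b"
    using assms by (intro V.lincomb_cong) auto
  also have "\<dots> = lincomb (V n) k x b \<oplus>\<^bsub>V n\<^esub> lincomb (V n) k y b"
    using assms by (intro V.lincomb_add pts_Pi) auto
  finally show ?thesis .
qed

lemma lincomb_V_smult:
  assumes "b \<in> {..<k} \<rightarrow> pts n" "a \<in> carrier R" "y \<in> pts k"
  shows "lincomb (V n) k (a \<odot>\<^bsub>V k\<^esub> y) b = a \<odot>\<^bsub>V n\<^esub> lincomb (V n) k y b"
proof -
  have "lincomb (V n) k (a \<odot>\<^bsub>V k\<^esub> y) b = lincomb (V n) k (\<lambda>j. a \<otimes> y j) b"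
    using assms by (intro V.lincomb_cong) auto
  also have "\<dots> = a \<odot>\<^bsub>V n\<^esub> lincomb (V n) k y b"
    using assms by (intro V.lincomb_smult pts_Pi) auto
  finally show ?thesis .
qed

lemma lincomb_V_uminus:
  assumes "b \<in> {..<k} \<rightarrow> pts n" "y \<in> pts k"
  shows "lincomb (V n) k (\<ominus>\<^bsub>V k\<^esub> y) b = \<ominus>\<^bsub>V n\<^esub> lincomb (V n) k y b"
  using lincomb_V_smult[OF assms(1) _ assms(2), of "\<ominus> \<one>"] V.lincomb_closed[OF pts_Pi[OF assms(2)] assms(1)]
    assms(2) by (simp add: V.smult_l_minus V.smult_one)

lemma lincomb_V_zero:
  assumes "b \<in> {..<k} \<rightarrow> pts n"
  shows "lincomb (V n) k \<zero>\<^bsub>V k\<^esub> b = \<zero>\<^bsub>V n\<^esub>"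
  using lincomb_V_smult[OF assms, of \<zero> "\<zero>\<^bsub>V k\<^esub>"] V.lincomb_closed[OF pts_Pi assms, of "\<zero>\<^bsub>V k\<^esub>"] by simp

lemma lincomb_lincomb:
  assumes "b \<in> {..<k} \<rightarrow> pts n" "b' \<in> {..<m} \<rightarrow> pts k" "y \<in> {..<m} \<rightarrow> carrier R"
  shows "lincomb (V n) k (lincomb (V k) m y b') b = lincomb (V n) m y (\<lambda>j. lincomb (V n) k (b' j) b)"
  using assms(2,3)
proof (induction m)
  case 0
  then show ?case using assms(1) by (simp add: V.lincomb_0 lincomb_V_zero)
next
  case (Suc m)
  then have *: "b' \<in> {..<m} \<rightarrow> pts k" "y \<in> {..<m} \<rightarrow> carrier R" "b' m \<in> pts k" "y m \<in> carrier R"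
    by (auto simp: Pi_iff)
  have c: "(\<lambda>j. lincomb (V n) k (b' j) b) \<in> {..<Suc m} \<rightarrow> pts n"
    using Suc.prems(1) assms(1) by (auto simp: Pi_iff intro!: V.lincomb_closed)
  show ?case
    unfolding V.lincomb_Suc[OF Suc.prems(2,1)] V.lincomb_Suc[OF Suc.prems(2) c]
    using * assms(1) Suc.IH by (simp add: lincomb_V_add lincomb_V_smult V.lincomb_closed)
qed

text \<open>An explicit parametrization, because the recursion pulls functions back to
  \<open>pts k\<close> and pushes affine subspaces of \<open>pts k\<close> forward to
  \<open>pts n\<close>.\<close>

definition affine_param :: "nat \<Rightarrow> nat \<Rightarrow> (nat \<Rightarrow> 'a) set \<Rightarrow> bool" where
  "affine_param n k S \<longleftrightarrow>
     (\<exists>u\<in>pts n. \<exists>b\<in>{..<k} \<rightarrow> pts n. indep_on n k b {..<n} \<and>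
        S = (\<lambda>y. u \<oplus>\<^bsub>V n\<^esub> lincomb (V n) k y b) ` pts k)"

lemma indep_onD:
  assumes "indep_on n k b {..<n}" "y \<in> {..<k} \<rightarrow> carrier R" "lincomb (V n) k y b = \<zero>\<^bsub>V n\<^esub>" "j < k"
  shows "y j = \<zero>"
  using assms unfolding indep_on_def by auto

lemma indep_on_mono: "indep_on n k b Q \<Longrightarrow> Q \<subseteq> Q' \<Longrightarrow> indep_on n k b Q'"
  unfolding indep_on_def by blast

text \<open>Injectivity lets a partition of the parameter space be carried over to the
  coset.\<close>

lemma inj_on_affine:
  assumes b: "b \<in> {..<k} \<rightarrow> pts n" and ind: "indep_on n k b {..<n}" and u: "u \<in> pts n"
  shows "inj_on (\<lambda>y. u \<oplus>\<^bsub>V n\<^esub> lincomb (V n) k y b) (pts k)"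
proof (rule inj_onI)
  fix x y assume x: "x \<in> pts k" and y: "y \<in> pts k"
    and eq: "u \<oplus>\<^bsub>V n\<^esub> lincomb (V n) k x b = u \<oplus>\<^bsub>V n\<^esub> lincomb (V n) k y b"
  have L: "lincomb (V n) k x b \<in> pts n" "lincomb (V n) k y b \<in> pts n"
    using x y b by (auto intro!: V.lincomb_closed pts_Pi)
  then have "lincomb (V n) k x b = lincomb (V n) k y b"
    using eq V.M.add.right_cancel[OF u L] by (simp add: V.M.a_comm[OF u])
  then have "lincomb (V n) k (x \<ominus>\<^bsub>V k\<^esub> y) b = \<zero>\<^bsub>V n\<^esub>"
    using L x y b by (simp add: a_minus_def lincomb_V_add lincomb_V_uminus V.M.r_neg)
  then have "(x \<ominus>\<^bsub>V k\<^esub> y) j = \<zero>\<^bsub>V k\<^esub> j" if "j < k" for j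
    using indep_onD[OF ind _ _ that] x y that by (simp add: pts_Pi)
  then have "x \<ominus>\<^bsub>V k\<^esub> y = \<zero>\<^bsub>V k\<^esub>" using x y by (intro pts_eqI) auto
  then show "x = y"
    using x y V.M.minus_equality[where n = k and x = "\<ominus>\<^bsub>V k\<^esub> y" and y = x] by (simp add: a_minus_def)
qed

text \<open>Affine maps compose: base point and directions of \<open>S\<close> are mapped to those
  of the image. The directions stay independent because the linear map given by \<open>b\<close> has
  trivial kernel.\<close>

lemma affine_param_image:
  assumes b: "b \<in> {..<k} \<rightarrow> pts n" and ind: "indep_on n k b {..<n}" and u: "u \<in> pts n"
    and S: "affine_param k m S"
  shows "affine_param n m ((\<lambda>y. u \<oplus>\<^bsub>V n\<^esub> lincomb (V n) k y b) ` S)"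
proof -
  let ?L = "\<lambda>y. lincomb (V n) k y b"
  obtain u' b' where *: "u' \<in> pts k" "b' \<in> {..<m} \<rightarrow> pts k" "indep_on k m b' {..<k}"
    "S = (\<lambda>y. u' \<oplus>\<^bsub>V k\<^esub> lincomb (V k) m y b') ` pts m"
    using S unfolding affine_param_def by blast
  have L: "?L y \<in> pts n" if "y \<in> pts k" for y using V.lincomb_closed[OF pts_Pi[OF that] b] .
  have c: "(\<lambda>j. ?L (b' j)) \<in> {..<m} \<rightarrow> pts n" using *(2) L by (auto simp: Pi_iff)
  have eq: "u \<oplus>\<^bsub>V n\<^esub> ?L (u' \<oplus>\<^bsub>V k\<^esub> lincomb (V k) m y b')
      = (u \<oplus>\<^bsub>V n\<^esub> ?L u') \<oplus>\<^bsub>V n\<^esub> lincomb (V n) m y (\<lambda>j. ?L (b' j))" if "y \<in> pts m" for y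
  proof -
    have y: "y \<in> {..<m} \<rightarrow> carrier R" using that by (rule pts_Pi)
    have "lincomb (V k) m y b' \<in> pts k" using V.lincomb_closed[OF y *(2)] .
    then show ?thesis
      using *(1) b u L by (simp add: lincomb_V_add V.M.a_assoc lincomb_lincomb[OF b *(2) y, symmetric])
  qed
  have "indep_on n m (\<lambda>j. ?L (b' j)) {..<n}"
    unfolding indep_on_def
  proof (intro ballI impI allI)
    fix y j assume y: "y \<in> {..<m} \<rightarrow> carrier R" and j: "j < m"
      and 0: "\<forall>p\<in>{..<n}. lincomb (V n) m y (\<lambda>j. ?L (b' j)) p = \<zero>"
    have z: "lincomb (V k) m y b' \<in> pts k" using V.lincomb_closed[OF y *(2)] .
    have "?L (lincomb (V k) m y b') = \<zero>\<^bsub>V n\<^esub>"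
      using 0 L[OF z] by (intro pts_eqI) (auto simp: lincomb_lincomb[OF b *(2) y])
    then have "\<forall>p\<in>{..<k}. lincomb (V k) m y b' p = \<zero>"
      using indep_onD[OF ind pts_Pi[OF z]] by auto
    then show "y j = \<zero>" using *(3) y j unfolding indep_on_def by blast
  qed
  moreover have "(\<lambda>y. u \<oplus>\<^bsub>V n\<^esub> ?L y) ` S =
      (\<lambda>y. (u \<oplus>\<^bsub>V n\<^esub> ?L u') \<oplus>\<^bsub>V n\<^esub> lincomb (V n) m y (\<lambda>j. ?L (b' j))) ` pts m"
    unfolding *(4) image_image using eq by (intro image_cong) auto
  ultimately show ?thesis
    unfolding affine_param_def using c u L *(1) by (meson V.M.a_closed)
qed

lemma affine_param_pts: "affine_param n n (pts n)"
proof -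
  \<comment> \<open>The standard basis, with respect to which every point is its own coefficient
    vector.\<close>
  define e where "e = (\<lambda>j. \<lambda>i\<in>{..<n}. if i = j then \<one> else \<zero>)"
  have e: "e \<in> A \<rightarrow> pts n" for A by (auto simp: e_def pts_eq)
  have e_apply: "e j i = (if i = j then \<one> else \<zero>)" if "i < n" for i j
    using that by (simp add: e_def)
  have coord: "lincomb (V n) m y e i = (if i < m then y i else \<zero>)"
    if "m \<le> n" "y \<in> {..<n} \<rightarrow> carrier R" "i < n" for m y i
    using that(1)
  proof (induction m)
    case (Suc m)
    have "lincomb (V n) (Suc m) y e = lincomb (V n) m y e \<oplus>\<^bsub>V n\<^esub> y m \<odot>\<^bsub>V n\<^esub> e m"
      using Suc.prems that(2) by (intro V.lincomb_Suc e) (auto simp: Pi_iff)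
    moreover have "y m \<in> carrier R" "y i \<in> carrier R" using Suc.prems that by (auto simp: Pi_iff)
    ultimately show ?case using Suc that(3) by (auto simp: e_apply less_Suc_eq)
  qed (use that in \<open>simp add: V.lincomb_0\<close>)
  have "lincomb (V n) n y e = y" if y: "y \<in> pts n" for y
    using y coord[OF order_refl pts_Pi[OF y]] V.lincomb_closed[OF pts_Pi[OF y] e] by (intro pts_eqI) auto
  then have "pts n = (\<lambda>y. \<zero>\<^bsub>V n\<^esub> \<oplus>\<^bsub>V n\<^esub> lincomb (V n) n y e) ` pts n"
    by (auto simp: image_iff)
  moreover have "indep_on n n e {..<n}"
    unfolding indep_on_def using coord[OF order_refl] by auto
  ultimately show ?thesis
    unfolding affine_param_def
    by (intro bexI[of _ "\<zero>\<^bsub>V n\<^esub>"] bexI[of _ e] conjI e V.M.zero_closed)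
qed

lemma affine_param_point:
  assumes "u \<in> pts n"
  shows "affine_param n 0 {u}"
  unfolding affine_param_def
  by (intro bexI[of _ u] bexI[of _ "\<lambda>_. \<zero>\<^bsub>V n\<^esub>"]) (use assms in \<open>auto simp: indep_on_def V.lincomb_0\<close>)

lemma affine_subspace_dim_param:
  assumes "affine_param n k S"
  shows "affine_subspace_dim R (V n) k S"
proof -
  obtain u b where u: "u \<in> pts n" and b: "b \<in> {..<k} \<rightarrow> pts n" and ind: "indep_on n k b {..<n}"
    and S: "S = (\<lambda>y. u \<oplus>\<^bsub>V n\<^esub> lincomb (V n) k y b) ` pts k"
    using assms unfolding affine_param_def by blast
  let ?L = "\<lambda>y. lincomb (V n) k y b"
  let ?W = "?L ` pts k"
  have L: "?L y \<in> pts n" if "y \<in> pts k" for y using V.lincomb_closed[OF pts_Pi[OF that] b] .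
  \<comment> \<open>Coefficient families in \<open>is_basis\<close> are arbitrary outside
    \<open>{..<k}\<close>; restricting one gives a point of \<open>pts k\<close> with the same
    combination.\<close>
  have W: "?L y \<in> ?W" if "y \<in> {..<k} \<rightarrow> carrier R" for y
  proof -
    have "?L y = ?L (restrict y {..<k})"
      using that b by (intro V.lincomb_cong) auto
    then show ?thesis using that by (auto simp: pts_eq)
  qed
  have "submodule ?W R (V n)"
  proof (rule V.submoduleI)
    show "?W \<subseteq> pts n" using L by auto
    show "\<zero>\<^bsub>V n\<^esub> \<in> ?W" using lincomb_V_zero[OF b] by (auto intro!: image_eqI)
    show "\<ominus>\<^bsub>V n\<^esub> a \<in> ?W" if "a \<in> ?W" for a
      using that by (auto simp: lincomb_V_uminus[OF b, symmetric])
    show "a \<oplus>\<^bsub>V n\<^esub> a' \<in> ?W" if "a \<in> ?W" "a' \<in> ?W" for a a'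
      using that by (auto simp: lincomb_V_add[OF b, symmetric])
    show "c \<odot>\<^bsub>V n\<^esub> a \<in> ?W" if "c \<in> carrier R" "a \<in> ?W" for c a
      using that by (auto simp: lincomb_V_smult[OF b, symmetric])
  qed
  moreover have "is_basis R (V n) ?W k b"
    unfolding is_basis_def
  proof (intro conjI ballI impI allI)
    have "b j \<in> ?W" if "j < k" for j
    proof -
      have "?L (\<lambda>i. if i = j then \<one> else \<zero>) = (\<Oplus>\<^bsub>V n\<^esub>i\<in>{..<k}. if i = j then b i else \<zero>\<^bsub>V n\<^esub>)"
        unfolding lincomb_def using b by (intro V.M.finsum_cong') (auto simp: Pi_iff)
      also have "\<dots> = b j"
        using that b by (intro V.M.add.finprod_singleton_swap) auto
      finally show ?thesis using W[of "\<lambda>i. if i = j then \<one> else \<zero>"] by auto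
    qed
    then show "b \<in> {..<k} \<rightarrow> ?W" by auto
    show "\<exists>c\<in>{..<k} \<rightarrow> carrier R. w = ?L c" if "w \<in> ?W" for w
      using that pts_Pi by auto
    show "c j = \<zero>" if "c \<in> {..<k} \<rightarrow> carrier R" "?L c = \<zero>\<^bsub>V n\<^esub>" "j < k" for c j
      using indep_onD[OF ind that] .
  qed
  moreover have "S = ?W +>\<^bsub>V n\<^esub> u"
    unfolding S a_r_coset_def' using u L by (auto simp: V.M.a_comm[OF u])
  ultimately show ?thesis
    unfolding affine_subspace_dim_def using u by blast
qed

subsection \<open>The partition\<close>

lemma partition_on_cosets:
  assumes b: "b \<in> {..<k} \<rightarrow> pts n"
  shows "partition_on (pts n) ((\<lambda>u. (\<lambda>y. u \<oplus>\<^bsub>V n\<^esub> lincomb (V n) k y b) ` pts k) ` pts n)"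
proof (rule partition_on_cells)
  let ?L = "\<lambda>y. lincomb (V n) k y b"
  let ?c = "\<lambda>u. (\<lambda>y. u \<oplus>\<^bsub>V n\<^esub> ?L y) ` pts k"
  have L: "?L y \<in> pts n" if "y \<in> pts k" for y using V.lincomb_closed[OF pts_Pi[OF that] b] .
  show "?c u \<subseteq> pts n" if "u \<in> pts n" for u using that L by auto
  show "u \<in> ?c u" if "u \<in> pts n" for u
    by (rule image_eqI[of _ _ "\<zero>\<^bsub>V k\<^esub>"]) (use that in \<open>auto simp: lincomb_V_zero[OF b]\<close>)
  \<comment> \<open>One inclusion suffices: shifting back by the negative of \<open>y\<close> gives
    the other.\<close>
  have sub: "?c (u \<oplus>\<^bsub>V n\<^esub> ?L y) \<subseteq> ?c u" if "u \<in> pts n" "y \<in> pts k" for u y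
  proof
    fix w assume "w \<in> ?c (u \<oplus>\<^bsub>V n\<^esub> ?L y)"
    then obtain z where z: "z \<in> pts k" "w = u \<oplus>\<^bsub>V n\<^esub> ?L y \<oplus>\<^bsub>V n\<^esub> ?L z" by auto
    then have "w = u \<oplus>\<^bsub>V n\<^esub> ?L (y \<oplus>\<^bsub>V k\<^esub> z)"
      using that L by (simp add: lincomb_V_add[OF b] V.M.a_assoc)
    then show "w \<in> ?c u" using that z by blast
  qed
  show "?c w = ?c u" if u: "u \<in> pts n" and w: "w \<in> ?c u" for u w
  proof
    obtain y where y: "y \<in> pts k" "w = u \<oplus>\<^bsub>V n\<^esub> ?L y" using w by auto
    show "?c w \<subseteq> ?c u" using sub u y by simp
    have "w \<oplus>\<^bsub>V n\<^esub> ?L (\<ominus>\<^bsub>V k\<^esub> y) = u"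
      using u y L by (simp add: lincomb_V_uminus[OF b] V.M.a_assoc V.M.r_neg)
    moreover have "w \<in> pts n" "\<ominus>\<^bsub>V k\<^esub> y \<in> pts k" using u y L by auto
    ultimately show "?c u \<subseteq> ?c w" using sub by metis
  qed
qed

lemma polyfun_0_constant:
  assumes "polyfun n 0 f"
  shows "f constant_on pts n"
proof -
  have "\<exists>c\<in>carrier R. \<forall>x\<in>pts n. f x = c"
    using assms
  proof (induction rule: polyfun.induct)
    case (add_mon f c l)
    then obtain c' where "c' \<in> carrier R" "\<forall>x\<in>pts n. f x = c'" by blast
    then show ?case using add_mon.hyps by (intro bexI[of _ "c' \<oplus> c"]) auto
  qed auto
  then show ?thesis unfolding constant_on_def by blast
qed

text \<open>\<open>\<kappa> j\<close> is the dimension of the pieces on which the functions have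
  degree at most \<open>j\<close>. One sequence governs all pieces, so every final part has the same
  dimension \<open>\<kappa> 0\<close>.\<close>

lemma constant_partition:
  assumes "\<And>j. j < d \<Longrightarrow> t * (Suc j * \<kappa> j ^ j) + \<kappa> j \<le> \<kappa> (Suc j)"
    and "\<And>i. i < t \<Longrightarrow> polyfun (\<kappa> d) d (f i)"
  shows "\<exists>P. partition_on (pts (\<kappa> d)) P \<and>
    (\<forall>S\<in>P. affine_param (\<kappa> d) (\<kappa> 0) S \<and> (\<forall>i<t. f i constant_on S))"
  using assms
proof (induction d arbitrary: f)
  case 0
  have "pts (\<kappa> 0) \<noteq> {}" using V.M.zero_closed by blast
  then show ?case
    using 0 by (intro exI[of _ "{pts (\<kappa> 0)}"])
      (auto simp: partition_on_space affine_param_pts polyfun_0_constant)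
next
  case (Suc d)
  let ?n = "\<kappa> (Suc d)" and ?k = "\<kappa> d"
  obtain T g where Tg: "\<And>i. i < t \<Longrightarrow> tensor ?n (Suc d) (T i)" "\<And>i. i < t \<Longrightarrow> polyfun ?n d (g i)"
    "\<And>i x. i < t \<Longrightarrow> x \<in> pts ?n \<Longrightarrow> f i x = T i (replicate (Suc d) x) \<oplus> g i x"
    using polyfun_top_part[OF Suc.prems(2)] by metis
  obtain b Q where b: "b \<in> {..<?k} \<rightarrow> pts ?n" and "Q \<subseteq> {..<?n}" "indep_on ?n ?k b Q"
    and vanish: "\<And>i J. i < t \<Longrightarrow> length J = Suc d \<Longrightarrow> set J \<subseteq> {..<?k} \<Longrightarrow> T i (map b J) = \<zero>"
    using common_isotropic_vectors[of t ?n d T ?k, OF Tg(1)] Suc.prems(1)[of d] by auto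
  then have ind: "indep_on ?n ?k b {..<?n}" using indep_on_mono by blast
  let ?\<psi> = "\<lambda>u y. u \<oplus>\<^bsub>V ?n\<^esub> lincomb (V ?n) ?k y b"
  let ?c = "\<lambda>u. ?\<psi> u ` pts ?k"
  \<comment> \<open>The induction hypothesis is applied to the pullbacks along
    \<open>?\<psi> u\<close>, one family of functions for each \<open>u\<close>.\<close>
  have "\<exists>P. partition_on (pts ?k) P \<and>
      (\<forall>S\<in>P. affine_param ?k (\<kappa> 0) S \<and> (\<forall>i<t. (\<lambda>y. f i (?\<psi> u y)) constant_on S))"
    if u: "u \<in> pts ?n" for u
  proof (rule Suc.IH)
    show "polyfun ?k d (\<lambda>y. f i (?\<psi> u y))" if "i < t" for i
      using that by (intro polyfun_restrict[OF Tg(3) Tg(1,2) b u vanish]) auto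
  qed (use Suc.prems(1) in auto)
  then obtain P where P: "\<And>u. u \<in> pts ?n \<Longrightarrow> partition_on (pts ?k) (P u)"
    "\<And>u S. u \<in> pts ?n \<Longrightarrow> S \<in> P u \<Longrightarrow> affine_param ?k (\<kappa> 0) S"
    "\<And>u S i. u \<in> pts ?n \<Longrightarrow> S \<in> P u \<Longrightarrow> i < t \<Longrightarrow> (\<lambda>y. f i (?\<psi> u y)) constant_on S"
    by metis
  \<comment> \<open>Several base points may describe the same coset; \<open>r\<close> fixes one per
    coset, so that a single partition of it is chosen.\<close>
  define r where "r = inv_into (pts ?n) ?c"
  have r: "r C \<in> pts ?n" "?c (r C) = C" if "C \<in> ?c ` pts ?n" for C
    unfolding r_def using that by (rule inv_into_into, rule f_inv_into_f)
  let ?Q = "\<lambda>C. (`) (?\<psi> (r C)) ` P (r C) - {{}}"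
  have "partition_on C (?Q C)" if C: "C \<in> ?c ` pts ?n" for C
    using partition_on_inj_image[OF P(1)[OF r(1)[OF C]] inj_on_affine[OF b ind r(1)[OF C]]]
    by (simp add: r(2)[OF C])
  then have "partition_on (pts ?n) (\<Union>C\<in>?c ` pts ?n. ?Q C)"
    by (rule partition_on_refine[OF partition_on_cosets[OF b]])
  moreover have "affine_param ?n (\<kappa> 0) S \<and> (\<forall>i<t. f i constant_on S)"
    if S: "S \<in> (\<Union>C\<in>?c ` pts ?n. ?Q C)" for S
  proof -
    obtain C S' where C: "C \<in> ?c ` pts ?n" and S': "S' \<in> P (r C)" "S = ?\<psi> (r C) ` S'"
      using S by blast
    note rC = r(1)[OF C]
    show ?thesis
      using affine_param_image[OF b ind rC P(2)[OF rC S'(1)]] P(3)[OF rC S'(1)] S'(2)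
      by (auto simp: constant_on_def)
  qed
  ultimately show ?case by blast
qed

end

subsection \<open>The dimension bound\<close>

text \<open>The least dimension from which the recursion for degree \<open>j\<close> reaches dimension \<open>k\<close>.\<close>

primrec dim_needed :: "nat \<Rightarrow> nat \<Rightarrow> nat \<Rightarrow> nat" where
  "dim_needed t k 0 = k"
| "dim_needed t k (Suc j) = t * (Suc j * dim_needed t k j ^ j) + dim_needed t k j"

definition exp_partial_sum :: "nat \<Rightarrow> real" where
  "exp_partial_sum r = (\<Sum>j<r. 1 / fact j)"

lemma exp_partial_sum_le: "exp_partial_sum r \<le> exp 1"
proof -
  have "(\<lambda>j. 1 / fact j) sums exp (1 :: real)"
    using exp_converges[of "1 :: real"] by (simp add: divide_inverse)
  then show ?thesis
    unfolding exp_partial_sum_def sums_iff using sum_le_suminf[of "\<lambda>j. 1 / fact j :: real" "{..<r}"]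
    by auto
qed

text \<open>Source of the base 3: a factor \<open>r + 3\<close> from one step of the recursion is
  absorbed into \<open>3 ^ Suc r\<close>, whose root of order \<open>fact (Suc r)\<close> is
  \<open>3 powr (1 / fact r)\<close>.\<close>

lemma add_3_le_power: "real r + 3 \<le> 3 ^ Suc r"
  by (induction r) auto

lemma powr_inverse_power: "x > 0 \<Longrightarrow> m > 0 \<Longrightarrow> (x powr (1 / real m)) ^ m = x"
  by (simp add: powr_power)

text \<open>One step of the recursion gives at most \<open>(r + 3) * t\<close> times the power
  \<open>Suc r\<close> of the previous value. After a root of order \<open>fact (Suc r)\<close>,
  this adds \<open>1 / fact r\<close> to the exponent of 3 and \<open>1 / fact (Suc r)\<close> to
  that of \<open>t\<close>.\<close>

lemma dim_needed_le:
  assumes "t \<ge> 1" "1 \<le> B" "real k \<le> 2 * B"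
  shows "real (dim_needed t k (Suc r))
    \<le> (3 powr (1 + exp_partial_sum r) * real t powr exp_partial_sum (Suc r) * B) ^ fact r"
proof (induction r)
  case 0
  \<comment> \<open>\<open>dim_needed t k 1\<close> is \<open>t + k\<close>, which is to be bounded
    by \<open>3 * t * B\<close>.\<close>
  have "real t + real k \<le> real t * B + 2 * (real t * B)"
  proof (rule add_mono)
    show "real t \<le> real t * B" using assms by simp
    have "B \<le> real t * B" using assms by simp
    with assms(3) show "real k \<le> 2 * (real t * B)" by linarith
  qed
  then show ?case using assms by (simp add: exp_partial_sum_def ac_simps)
next
  case (Suc r)
  let ?\<kappa> = "real (dim_needed t k (Suc r))"
  let ?X = "3 powr (1 + exp_partial_sum r) * real t powr exp_partial_sum (Suc r) * B"
  let ?a = "3 powr (1 / fact r) :: real" and ?b = "real t powr (1 / fact (Suc r))"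
  have t: "real t > 0" using assms by simp
  \<comment> \<open>This absorbs the linear summand of the recursion into the power; zero is treated
    separately, since \<open>x \<le> x ^ m\<close> is taken from \<open>x \<ge> 1\<close>.\<close>
  have \<kappa>: "?\<kappa> \<le> real t * ?\<kappa> ^ Suc r"
  proof (cases "dim_needed t k (Suc r) = 0")
    case False
    then have "?\<kappa> \<le> ?\<kappa> ^ Suc r" by (intro self_le_power) (simp_all del: dim_needed.simps)
    also have "\<dots> \<le> real t * ?\<kappa> ^ Suc r"
      using assms(1) mult_right_mono[of 1 "real t" "?\<kappa> ^ Suc r"] by (simp del: dim_needed.simps)
    finally show ?thesis .
  qed (simp del: dim_needed.simps)
  have a: "?a ^ fact (Suc r) = 3 ^ Suc r"
  proof -
    have "?a ^ fact (Suc r) = (?a ^ fact r) ^ Suc r" by (simp only: fact_Suc of_nat_id mult.commute power_mult)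
    then show ?thesis using powr_inverse_power[of 3 "fact r"] by simp
  qed
  have b: "?b ^ fact (Suc r) = real t"
    using powr_inverse_power[OF t fact_gt_zero[of "Suc r"]] by (simp only: of_nat_fact)
  have "real (dim_needed t k (Suc (Suc r))) = real t * ((real r + 2) * ?\<kappa> ^ Suc r) + ?\<kappa>"
    by (simp only: dim_needed.simps(2)[of t k "Suc r"]) (simp add: algebra_simps del: dim_needed.simps)
  also have "\<dots> \<le> real t * ((real r + 2) * ?\<kappa> ^ Suc r) + real t * ?\<kappa> ^ Suc r"
    using \<kappa> by simp
  also have "\<dots> = (real r + 3) * (real t * ?\<kappa> ^ Suc r)" by (simp only: algebra_simps)
  also have "\<dots> \<le> 3 ^ Suc r * (real t * ?\<kappa> ^ Suc r)"
    by (intro mult_right_mono add_3_le_power) simp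
  also have "\<dots> \<le> 3 ^ Suc r * (real t * (?X ^ fact r) ^ Suc r)"
    by (intro mult_left_mono power_mono Suc.IH) simp_all
  also have "(?X ^ fact r) ^ Suc r = ?X ^ fact (Suc r)"
    by (simp only: fact_Suc of_nat_id mult.commute power_mult)
  also have "3 ^ Suc r * (real t * ?X ^ fact (Suc r)) = (?X * ?a * ?b) ^ fact (Suc r)"
    unfolding power_mult_distrib[of "?X * ?a"] power_mult_distrib[of ?X ?a] a b by (simp only: ac_simps)
  also have "?X * ?a * ?b
      = 3 powr (1 + exp_partial_sum (Suc r)) * real t powr exp_partial_sum (Suc (Suc r)) * B"
  proof -
    have "3 powr (1 + exp_partial_sum (Suc r)) = 3 powr (1 + exp_partial_sum r) * ?a"
      by (simp add: exp_partial_sum_def powr_add[symmetric] add.assoc)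
    moreover have "real t powr exp_partial_sum (Suc (Suc r)) = real t powr exp_partial_sum (Suc r) * ?b"
      by (simp only: exp_partial_sum_def sum.lessThan_Suc powr_add)
    ultimately show ?thesis by (simp only: ac_simps)
  qed
  finally show ?case .
qed

text \<open>\<open>B\<close> solves
  \<open>3 powr (1 + exp 1) * t powr exp 1 * B = n powr (1 / fact r)\<close>. The power
  \<open>fact r\<close> of the left side dominates the bound with partial sums, and that of the
  right side is \<open>n\<close>.\<close>

lemma dim_needed_le_dim:
  fixes n t r :: nat
  defines "B \<equiv> 3 powr (- (1 + exp 1)) * real n powr (1 / fact r) / real t powr exp 1"
  assumes "t \<ge> 1" "1 \<le> B"
  shows "dim_needed t (nat \<lceil>B\<rceil>) (Suc r) \<le> n"
proof -
  have n: "real n > 0"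
    using assms(3) by (cases "n = 0") (auto simp: B_def)
  have t: "real t \<ge> 1" using assms(2) by simp
  let ?X = "3 powr (1 + exp_partial_sum r) * real t powr exp_partial_sum (Suc r) * B"
  \<comment> \<open>Rounding up costs at most 1, which is at most \<open>B\<close>.\<close>
  have "real (nat \<lceil>B\<rceil>) \<le> 2 * B" using assms(3) by linarith
  from dim_needed_le[OF assms(2,3) this]
  have "real (dim_needed t (nat \<lceil>B\<rceil>) (Suc r)) \<le> ?X ^ fact r" .
  \<comment> \<open>The partial sums may be raised to \<open>exp 1\<close> because the bases 3 and
    \<open>t\<close> are at least 1.\<close>
  also have "\<dots> \<le> (3 powr (1 + exp 1) * real t powr exp 1 * B) ^ fact r"
    using t assms(3)
    by (intro power_mono mult_right_mono mult_mono powr_mono add_left_mono exp_partial_sum_le) auto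
  also have "3 powr (1 + exp 1) * real t powr exp 1 * B = real n powr (1 / fact r)"
  proof -
    have "3 powr (1 + exp 1) * 3 powr (- (1 + exp 1)) = (1 :: real)"
      by (subst powr_add[symmetric]) simp
    moreover have "3 powr (1 + exp 1) * real t powr exp 1 * B
        = (3 powr (1 + exp 1) * 3 powr (- (1 + exp 1))) * real n powr (1 / fact r)"
      unfolding B_def using t by simp
    ultimately show ?thesis by simp
  qed
  also have "\<dots> ^ fact r = real n"
    using powr_inverse_power[OF n, of "fact r"] by simp
  finally show ?thesis by (simp only: of_nat_le_iff)
qed

theorem theorem3p6:
  shows "\<exists>c::real. c > 0 \<and>
    (\<forall>(q::nat) (F :: nat ring) (n::nat) (d::nat) (t::nat) (f :: nat \<Rightarrow> (nat \<Rightarrow> nat) \<Rightarrow> nat).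
       primepow q \<and> field F \<and> order F = q \<and> d \<ge> 1 \<and> t \<ge> 1 \<and>
       (\<forall>i<t. f i \<in> carrier (coord_space F n) \<rightarrow> carrier F \<and> degree_at_most F n d (f i)) \<longrightarrow>
       (let B = c * real n powr (1 / fact (d - 1)) / real t powr exp 1 in
        \<exists>P. partition_on (carrier (coord_space F n)) P \<and>
          (\<forall>V\<in>P. \<exists>k. affine_subspace_dim F (coord_space F n) k V \<and>
                     (1 \<le> B \<longrightarrow> B \<le> real k) \<and>
                     (\<forall>i<t. f i constant_on V))))"
proof (intro exI[of _ "3 powr (- (1 + exp 1))"] conjI allI impI; (elim conjE)?)
  fix q n d t :: nat and F :: "nat ring" and f :: "nat \<Rightarrow> (nat \<Rightarrow> nat) \<Rightarrow> nat"
  assume q: "primepow q" and F: "field F" "order F = q" and d: "1 \<le> d" and t: "1 \<le> t"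
    and f: "\<forall>i<t. f i \<in> carrier (coord_space F n) \<rightarrow> carrier F \<and> degree_at_most F n d (f i)"
  define B where "B = 3 powr (- (1 + exp 1)) * real n powr (1 / fact (d - 1)) / real t powr exp 1"
  \<comment> \<open>An infinite carrier has \<open>card\<close> 0 and hence order 0, which is not a
    prime power.\<close>
  have "finite (carrier F)"
    using F(2) primepow_gt_0_nat[OF q] by (intro card_ge_0_finite) (simp add: order_def)
  with F(1) interpret finite_field F
    by (simp add: finite_field_def finite_field_axioms_def)
  have "\<exists>P. partition_on (pts n) P \<and> (\<forall>S\<in>P. \<exists>k. affine_subspace_dim F (V n) k S \<and>
          (1 \<le> B \<longrightarrow> B \<le> real k) \<and> (\<forall>i<t. f i constant_on S))"
  proof (cases "1 \<le> B")
    case True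
    \<comment> \<open>The exact requirements are used below \<open>d\<close>; at \<open>d\<close>
      the value is \<open>n\<close> itself, and the last step absorbs the slack.\<close>
    define \<kappa> where "\<kappa> = (\<lambda>j. if j < d then dim_needed t (nat \<lceil>B\<rceil>) j else n)"
    have "dim_needed t (nat \<lceil>B\<rceil>) d \<le> n"
      using dim_needed_le_dim[of t n "d - 1"] t d True by (simp add: B_def)
    then have step: "t * (Suc j * \<kappa> j ^ j) + \<kappa> j \<le> \<kappa> (Suc j)" if "j < d" for j
      using that by (cases "Suc j = d") (auto simp: \<kappa>_def)
    have "\<kappa> d = n" "\<kappa> 0 = nat \<lceil>B\<rceil>" using d by (auto simp: \<kappa>_def)
    with constant_partition[of d t \<kappa> f, OF step] f
    obtain P where P: "partition_on (pts n) P"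
      "\<And>S. S \<in> P \<Longrightarrow> affine_param n (nat \<lceil>B\<rceil>) S" "\<And>S i. S \<in> P \<Longrightarrow> i < t \<Longrightarrow> f i constant_on S"
      using polyfun_degree_at_most by auto
    have "B \<le> real (nat \<lceil>B\<rceil>)" by linarith
    with P affine_subspace_dim_param show ?thesis by blast
  next
    \<comment> \<open>With \<open>B\<close> below 1 no dimension is demanded, and single points, of
      dimension 0, serve as parts.\<close>
    case False
    have "\<exists>k. affine_subspace_dim F (V n) k S \<and> (\<forall>i<t. f i constant_on S)"
      if "S \<in> (\<lambda>u. {u}) ` pts n" for S
      using that affine_subspace_dim_param[OF affine_param_point] by (auto simp: constant_on_def)
    with False partition_on_singletons show ?thesis by blast
  qed
  then show "let B = 3 powr (- (1 + exp 1)) * real n powr (1 / fact (d - 1)) / real t powr exp 1 in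
        \<exists>P. partition_on (carrier (coord_space F n)) P \<and>
          (\<forall>V\<in>P. \<exists>k. affine_subspace_dim F (coord_space F n) k V \<and>
                     (1 \<le> B \<longrightarrow> B \<le> real k) \<and>
                     (\<forall>i<t. f i constant_on V))"
    unfolding Let_def B_def .
qed simp

end
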